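(* Let $X$ be the solution of the stochastic differential equation $dX_t=-\alpha(t)X_t\,dt+dW_t$, $t\in[0,\infty)$, $X_0=0$, where $\alpha$ is a deterministic function on $[0,\infty)$ (measurable and bounded on bounded intervals). For $\varepsilon>0$ let $$\mathcal L_{t,\varepsilon}^x:=\int_0^t p_\varepsilon(X_r-x)\,dr,\qquad p_\varepsilon(y)=\frac1{\sqrt{2\pi\varepsilon}}\exp\left(-\frac{y^2}{2\varepsilon}\right).$$ Then for any $0<t<\infty$ and any $x\in\mathbb R$ the local time $\mathcal L_t^x$ exists as an $L^2$-limit, i.e. there is a square-integrable random variable $\mathcal L_t^x$ such that $$\lim_{\varepsilon\to0+}\mathbb E\left|\mathcal L_{t,\varepsilon}^x-\mathcal L_t^x\right|^2=0 .$$
   Context: $W=(W_t)_{t\ge0}$ is a standard one-dimensional Brownian motion on a complete filtered probability space. The equation has a unique strong solution, $X_t=\int_0^t\exp\left(-\int_s^t\alpha(u)\,du\right)dW_s$ for $0\le t<\infty$. The local time of $X$ at level $x$, formally $\mathcal L_t^x=\int_0^t\delta(X_r-x)\,dr$ with $\delta$ the Dirac delta function at $0$, is by definition the $L^2$-limit of $\mathcal L_{t,\varepsilon}^x$ as $\varepsilon\to0+$, if this limit exists. *)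

theory Defs
  imports "HOL-Probability.Probability"
begin

text \<open>Time is the half-line \<open>[0,\<infinity>)\<close> inside type \<^typ>\<open>real\<close>: nothing is required of processes,
  filtrations or coefficients at negative times.\<close>

locale complete_filtered_prob_space = prob_space M + complete_measure M
  for M :: "'a measure" and F :: "real \<Rightarrow> 'a measure" +
  assumes subalg: "0 \<le> t \<Longrightarrow> subalgebra M (F t)"
    and F_mono: "0 \<le> s \<Longrightarrow> s \<le> t \<Longrightarrow> sets (F s) \<subseteq> sets (F t)"
    and F_null: "0 \<le> t \<Longrightarrow> null_sets M \<subseteq> sets (F t)"

definition adapted :: "(real \<Rightarrow> 'a measure) \<Rightarrow> (real \<Rightarrow> 'a \<Rightarrow> real) \<Rightarrow> bool" where
  "adapted F X \<longleftrightarrow> (\<forall>t\<ge>0. X t \<in> borel_measurable (F t))"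

definition continuous_paths :: "'a measure \<Rightarrow> (real \<Rightarrow> 'a \<Rightarrow> real) \<Rightarrow> bool" where
  "continuous_paths M X \<longleftrightarrow> (AE \<omega> in M. continuous_on {0..} (\<lambda>t. X t \<omega>))"

definition brownian_motion ::
    "'a measure \<Rightarrow> (real \<Rightarrow> 'a measure) \<Rightarrow> (real \<Rightarrow> 'a \<Rightarrow> real) \<Rightarrow> bool" where
  "brownian_motion M F W \<longleftrightarrow>
     adapted F W \<and> continuous_paths M W \<and> (AE \<omega> in M. W 0 \<omega> = 0) \<and>
     (\<forall>s t. 0 \<le> s \<and> s < t \<longrightarrow>
        prob_space.indep_set M (sets (F s))
          (sets (vimage_algebra (space M) (\<lambda>\<omega>. W t \<omega> - W s \<omega>) borel)) \<and>
        distributed M lborel (\<lambda>\<omega>. W t \<omega> - W s \<omega>) (normal_density 0 (sqrt (t - s))))"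

text \<open>The equation \<open>dX\<^sub>t = - \<alpha>(t) X\<^sub>t dt + dW\<^sub>t\<close>, \<open>X\<^sub>0 = 0\<close>, in its usual integrated form. The noise is
  additive, so the stochastic integral is just \<open>\<integral>\<^sub>0\<^sup>t dW\<^sub>s = W\<^sub>t - W\<^sub>0\<close>.\<close>

definition sde_solution ::
    "'a measure \<Rightarrow> (real \<Rightarrow> 'a measure) \<Rightarrow> (real \<Rightarrow> 'a \<Rightarrow> real) \<Rightarrow> (real \<Rightarrow> real) \<Rightarrow>
     (real \<Rightarrow> 'a \<Rightarrow> real) \<Rightarrow> bool" where
  "sde_solution M F W \<alpha> X \<longleftrightarrow>
     adapted F X \<and> continuous_paths M X \<and> (AE \<omega> in M. X 0 \<omega> = 0) \<and>
     (AE \<omega> in M. \<forall>t\<ge>0.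
        set_integrable lebesgue {0..t} (\<lambda>s. \<alpha> s * X s \<omega>) \<and>
        X t \<omega> = X 0 \<omega> - (LINT s:{0..t}|lebesgue. \<alpha> s * X s \<omega>) + (W t \<omega> - W 0 \<omega>))"

definition heat_kernel :: "real \<Rightarrow> real \<Rightarrow> real" where
  "heat_kernel \<epsilon> y = 1 / sqrt (2 * pi * \<epsilon>) * exp (- y\<^sup>2 / (2 * \<epsilon>))"

definition approx_local_time ::
    "(real \<Rightarrow> 'a \<Rightarrow> real) \<Rightarrow> real \<Rightarrow> real \<Rightarrow> real \<Rightarrow> 'a \<Rightarrow> real" where
  "approx_local_time X t x \<epsilon> \<omega> = (LINT r:{0..t}|lebesgue. heat_kernel \<epsilon> (X r \<omega> - x))"

definition square_integrable :: "'a measure \<Rightarrow> ('a \<Rightarrow> real) \<Rightarrow> bool" where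
  "square_integrable M Y \<longleftrightarrow> Y \<in> borel_measurable M \<and> integrable M (\<lambda>\<omega>. (Y \<omega>)\<^sup>2)"

text \<open>Membership of the approximations in \<open>L\<^sup>2\<close> is part of the definition: otherwise the Bochner integral
  below could vanish merely because its integrand is not integrable.\<close>

definition is_local_time ::
    "'a measure \<Rightarrow> (real \<Rightarrow> 'a \<Rightarrow> real) \<Rightarrow> real \<Rightarrow> real \<Rightarrow> ('a \<Rightarrow> real) \<Rightarrow> bool" where
  "is_local_time M X t x L \<longleftrightarrow>
     (\<forall>\<epsilon>>0. square_integrable M (approx_local_time X t x \<epsilon>)) \<and>
     square_integrable M L \<and>
     ((\<lambda>\<epsilon>. \<integral>\<omega>. \<bar>approx_local_time X t x \<epsilon> \<omega> - L \<omega>\<bar>\<^sup>2 \<partial>M) \<longlongrightarrow> 0) (at_right 0)"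

end

theory Submission
  imports Defs
begin

text \<open>
  With \<open>k u = exp (- \<integral>\<^sub>u\<^sup>r \<alpha>)\<close>, the variable \<open>X\<^sub>r - k s X\<^sub>s\<close> is the pathwise limit of the sums
  \<open>\<Sum>\<^sub>i k (u\<^sub>i) (W (u\<^sub>i\<^sub>+\<^sub>1) - W (u\<^sub>i))\<close> over uniform partitions of \<open>[s, r]\<close>. Passing to the limit in the
  characteristic functions restricted to events of \<open>F\<^sub>s\<close>, Levy's uniqueness theorem shows that it is
  independent of \<open>F\<^sub>s\<close> and centred normal with variance at least \<open>c (r - s)\<close>. Substituting the kernels into the
  standard normal law, \<open>E [p\<^sub>\<epsilon> (X\<^sub>s - x) p\<^sub>\<delta> (X\<^sub>r - x)]\<close> converges as \<open>\<epsilon>, \<delta> \<rightarrow> 0\<close> and is bounded by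
  \<open>C / sqrt (s (r - s))\<close>, which is integrable over \<open>0 < s < r < t\<close>. Dominated convergence then makes
  the approximations Cauchy in \<open>L\<^sup>2\<close>.
\<close>

text \<open>The obstacle is that the kernels blow up while the limit is taken inside a second
  moment. Squaring the difference of two approximations gives four two-point expectations, two with
  sign plus and two with sign minus. For fixed times \<open>s < r\<close> all four tend to the same
  number, the joint density of \<open>X s\<close> and \<open>X r\<close> at (x, x), so their
  combination tends to 0. A bound uniform in both widths follows from upper bounds on two normal
  densities, hence from lower bounds on variances: if B bounds the modulus of \<alpha> on [0, r],
  the exponent of k has modulus at most B r, whence c = exp (- 2 B r). Riemann sums can stand in for
  a stochastic integral because k is deterministic and the noise additive. As \<alpha> is merely
  bounded and measurable, each cell of the partition is compared with the integral equation directly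
  instead of differentiating k X. Paths of X are continuous only almost surely and only on the
  half-line; the joint measurability that Fubini requires comes from a modification, and
  completeness of the measure carries measurability back to X.\<close>

section \<open>Completeness of L2 for families indexed by a width tending to 0 from the
  right\<close>

text \<open>The Riesz-Fischer argument: along a fast sequence of widths the increments are summable
  in L1, so the sequence converges almost everywhere. Fatou's lemma then passes the Cauchy bound to
  the limit for every small width, not just along the sequence.\<close>

lemma L2_Cauchy_at_right_imp_convergent:
  fixes f :: "real \<Rightarrow> 'a \<Rightarrow> real"
  assumes sq: "\<And>e. 0 < e \<Longrightarrow> square_integrable M (f e)"
    and Cauchy: "\<And>\<eta>. 0 < \<eta> \<Longrightarrow> \<exists>\<delta>>0. \<forall>e e'. 0 < e \<and> e < \<delta> \<and> 0 < e' \<and> e' < \<delta> \<longrightarrow>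
      (\<integral>\<omega>. (f e \<omega> - f e' \<omega>)\<^sup>2 \<partial>M) < \<eta>"
    and fin: "finite_measure M"
  shows "\<exists>L. square_integrable M L \<and>
    ((\<lambda>e. \<integral>\<omega>. \<bar>f e \<omega> - L \<omega>\<bar>\<^sup>2 \<partial>M) \<longlongrightarrow> 0) (at_right 0)"
proof -
  interpret finite_measure M by (rule fin)
  have meas: "f e \<in> borel_measurable M" if "0 < e" for e
    using sq[OF that] by (simp add: square_integrable_def)
  have int2: "integrable M (\<lambda>\<omega>. (f e \<omega>)\<^sup>2)" if "0 < e" for e
    using sq[OF that] by (simp add: square_integrable_def)
  have intd: "integrable M (\<lambda>\<omega>. (f e \<omega> - f e' \<omega>)\<^sup>2)" if "0 < e" "0 < e'" for e e'
  proof (rule Bochner_Integration.integrable_bound)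
    show "integrable M (\<lambda>\<omega>. 2 * (f e \<omega>)\<^sup>2 + 2 * (f e' \<omega>)\<^sup>2)"
      using int2 that by auto
    show "(\<lambda>\<omega>. (f e \<omega> - f e' \<omega>)\<^sup>2) \<in> borel_measurable M"
      using meas[OF that(1)] meas[OF that(2)] by measurable
    have "(a - b)\<^sup>2 \<le> 2 * a\<^sup>2 + 2 * b\<^sup>2" for a b :: real
      using zero_le_power2[of "a + b"] by (simp add: power2_eq_square algebra_simps)
    then show "AE \<omega> in M. norm ((f e \<omega> - f e' \<omega>)\<^sup>2) \<le> norm (2 * (f e \<omega>)\<^sup>2 + 2 * (f e' \<omega>)\<^sup>2)"
      by simp
  qed
  have "\<exists>d. \<forall>n::nat. 0 < d n \<and> (\<forall>e e'. 0 < e \<and> e < d n \<and> 0 < e' \<and> e' < d n \<longrightarrow>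
      (\<integral>\<omega>. (f e \<omega> - f e' \<omega>)\<^sup>2 \<partial>M) < (1/4)^n)"
    by (rule choice, rule allI, rule Cauchy) simp
  then obtain d where d0: "\<And>n::nat. 0 < d n"
    and d: "\<And>n e e'. 0 < e \<Longrightarrow> e < d n \<Longrightarrow> 0 < e' \<Longrightarrow> e' < d n \<Longrightarrow>
      (\<integral>\<omega>. (f e \<omega> - f e' \<omega>)\<^sup>2 \<partial>M) < (1/4)^n"
    by auto
  \<comment> \<open>The thresholds \<open>d\<close> need not decrease. Taking the minimum over
    \<open>{..n}\<close> puts \<open>e m\<close> below \<open>d n\<close> for every
    \<open>m \<ge> n\<close>, and halving makes the inequality strict.\<close>
  define e where "e n = Min (d ` {..n}) / 2" for n
  have e0: "0 < e n" for n
    using d0 by (auto simp: e_def)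
  have ed: "e m < d n" if "n \<le> m" for m n
  proof -
    have "Min (d ` {..m}) \<le> d n" using that by (intro Min_le) auto
    moreover have "Min (d ` {..m}) < 2 * Min (d ` {..m})" using e0[of m] by (simp add: e_def)
    ultimately show ?thesis unfolding e_def by linarith
  qed
  have nnd: "(\<integral>\<^sup>+\<omega>. ennreal ((f a \<omega> - f b \<omega>)\<^sup>2) \<partial>M) \<le> ennreal ((1/4)^n)"
    if "0 < a" "a < d n" "0 < b" "b < d n" for a b n
    using d[OF that] that by (subst nn_integral_eq_integral) (auto intro: intd ennreal_leI)
  define g where "g n = f (e n)" for n
  have [measurable]: "g n \<in> borel_measurable M" for n
    unfolding g_def by (rule meas[OF e0])
  define C where "C = measure M (space M)"
  have C0: "0 \<le> C" by (simp add: C_def)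
  have step: "(\<integral>\<^sup>+\<omega>. ennreal \<bar>g (Suc n) \<omega> - g n \<omega>\<bar> \<partial>M) \<le> ennreal ((1 + C) * (1/2)^n)" for n
  proof -
    \<comment> \<open>This replaces Cauchy-Schwarz on the finite measure space. The weight
      \<open>2^n\<close> is chosen so that, against the L2 bound \<open>(1/4)^n\<close>, both terms
      integrate to a multiple of \<open>(1/2)^n\<close>, which is summable.\<close>
    have amgm: "\<bar>z\<bar> \<le> 2^n * z\<^sup>2 + (1/2)^n" for z :: real
    proof (cases "\<bar>z\<bar> \<le> (1/2)^n")
      case False
      have "1 \<le> 2^n * \<bar>z\<bar>"
        using False by (simp add: power_divide field_simps)
      then have "1 * \<bar>z\<bar> \<le> 2^n * \<bar>z\<bar> * \<bar>z\<bar>" by (intro mult_right_mono) auto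
      then have "\<bar>z\<bar> \<le> 2^n * z\<^sup>2" by (simp add: power2_eq_square mult.assoc)
      then show ?thesis by (rule add_increasing2[rotated]) simp
    qed (simp add: add_increasing)
    have "(\<integral>\<^sup>+\<omega>. ennreal \<bar>g (Suc n) \<omega> - g n \<omega>\<bar> \<partial>M)
        \<le> (\<integral>\<^sup>+\<omega>. ennreal (2^n) * ennreal ((g (Suc n) \<omega> - g n \<omega>)\<^sup>2) + ennreal ((1/2)^n) \<partial>M)"
    proof (rule nn_integral_mono)
      fix \<omega>
      show "ennreal \<bar>g (Suc n) \<omega> - g n \<omega>\<bar>
        \<le> ennreal (2^n) * ennreal ((g (Suc n) \<omega> - g n \<omega>)\<^sup>2) + ennreal ((1/2)^n)"
        using amgm[of "g (Suc n) \<omega> - g n \<omega>"]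
        by (subst ennreal_mult[symmetric], simp, simp, subst ennreal_plus[symmetric])
          (auto intro!: ennreal_leI simp del: ennreal_plus)
    qed
    also have "\<dots> = ennreal (2^n) * (\<integral>\<^sup>+\<omega>. ennreal ((g (Suc n) \<omega> - g n \<omega>)\<^sup>2) \<partial>M) +
        ennreal ((1/2)^n) * emeasure M (space M)"
      by (simp add: nn_integral_add nn_integral_cmult)
    also have "\<dots> \<le> ennreal (2^n) * ennreal ((1/4)^n) + ennreal ((1/2)^n) * ennreal C"
      unfolding g_def C_def emeasure_eq_measure
      by (intro add_mono mult_left_mono nnd e0 ed) auto
    also have "\<dots> = ennreal (2^n * (1/4)^n + (1/2)^n * C)"
      using C0 by (simp add: ennreal_mult[symmetric] ennreal_plus[symmetric] del: ennreal_plus)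
    also have "2^n * (1/4)^n + (1/2)^n * C = (1 + C) * (1/2::real)^n"
      by (simp add: power_mult_distrib[symmetric] algebra_simps)
    finally show ?thesis .
  qed
  have "(\<integral>\<^sup>+\<omega>. (\<Sum>n. ennreal \<bar>g (Suc n) \<omega> - g n \<omega>\<bar>) \<partial>M) =
      (\<Sum>n. \<integral>\<^sup>+\<omega>. ennreal \<bar>g (Suc n) \<omega> - g n \<omega>\<bar> \<partial>M)"
    by (rule nn_integral_suminf) measurable
  also have "\<dots> \<le> (\<Sum>n. ennreal ((1 + C) * (1/2)^n))"
    by (rule suminf_le[OF step]) auto
  also have "\<dots> < \<infinity>"
    using C0 by (subst suminf_ennreal2) (auto intro!: summable_mult)
  finally have "AE \<omega> in M. (\<Sum>n. ennreal \<bar>g (Suc n) \<omega> - g n \<omega>\<bar>) \<noteq> \<infinity>"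
    by (intro nn_integral_noteq_infinite) auto
  then have conv: "AE \<omega> in M. convergent (\<lambda>n. g n \<omega>)"
  proof eventually_elim
    case (elim \<omega>)
    then have "summable (\<lambda>n. \<bar>g (Suc n) \<omega> - g n \<omega>\<bar>)"
      by (intro summable_suminf_not_top) auto
    then have "summable (\<lambda>n. g (Suc n) \<omega> - g n \<omega>)"
      by (rule summable_rabs_cancel)
    then have "convergent (\<lambda>n. \<Sum>i<n. g (Suc i) \<omega> - g i \<omega>)"
      by (simp add: summable_iff_convergent)
    then have "convergent (\<lambda>n. g n \<omega> - g 0 \<omega>)"
      using sum_lessThan_telescope[of "\<lambda>n. g n \<omega>"] by simp
    then show ?case
      by (simp add: convergent_diff_const_right_iff)
  qed
  define L where "L \<omega> = lim (\<lambda>n. g n \<omega>)" for \<omega>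
  have [measurable]: "L \<in> borel_measurable M"
    unfolding L_def by measurable
  \<comment> \<open>One width stays at \<open>a\<close> while the other runs along the sequence,
    which is what yields the bound for all \<open>a < d n\<close>.\<close>
  have fatou: "(\<integral>\<^sup>+\<omega>. ennreal ((f a \<omega> - L \<omega>)\<^sup>2) \<partial>M) \<le> ennreal ((1/4)^n)"
    if a: "0 < a" "a < d n" for a n
  proof -
    note [measurable] = meas[OF a(1)]
    have "(\<integral>\<^sup>+\<omega>. ennreal ((f a \<omega> - L \<omega>)\<^sup>2) \<partial>M)
        = (\<integral>\<^sup>+\<omega>. liminf (\<lambda>m. ennreal ((f a \<omega> - g m \<omega>)\<^sup>2)) \<partial>M)"
    proof (rule nn_integral_cong_AE, use conv in eventually_elim)
      case (elim \<omega>)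
      then have "(\<lambda>m. g m \<omega>) \<longlonglongrightarrow> L \<omega>"
        by (simp add: L_def convergent_LIMSEQ_iff)
      then have "(\<lambda>m. ennreal ((f a \<omega> - g m \<omega>)\<^sup>2)) \<longlonglongrightarrow> ennreal ((f a \<omega> - L \<omega>)\<^sup>2)"
        by (intro tendsto_ennrealI tendsto_intros)
      then show ?case
        by (rule lim_imp_Liminf[OF sequentially_bot, symmetric])
    qed
    also have "\<dots> \<le> liminf (\<lambda>m. \<integral>\<^sup>+\<omega>. ennreal ((f a \<omega> - g m \<omega>)\<^sup>2) \<partial>M)"
      by (rule nn_integral_liminf) measurable
    also have "\<dots> \<le> liminf (\<lambda>m. ennreal ((1/4)^n))"
    proof (rule Liminf_mono, rule eventually_sequentiallyI)
      show "(\<integral>\<^sup>+\<omega>. ennreal ((f a \<omega> - g m \<omega>)\<^sup>2) \<partial>M) \<le> ennreal ((1/4)^n)" if "n \<le> m" for m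
        unfolding g_def by (rule nnd[OF a e0 ed[OF that]])
    qed
    also have "\<dots> = ennreal ((1/4)^n)"
      by (simp add: Liminf_const)
    finally show ?thesis .
  qed
  have intL: "integrable M (\<lambda>\<omega>. (f a \<omega> - L \<omega>)\<^sup>2)" if a: "0 < a" "a < d n" for a n
  proof (rule integrableI_nonneg)
    show "(\<lambda>\<omega>. (f a \<omega> - L \<omega>)\<^sup>2) \<in> borel_measurable M"
      using meas[OF a(1)] by measurable
    show "(\<integral>\<^sup>+\<omega>. ennreal ((f a \<omega> - L \<omega>)\<^sup>2) \<partial>M) < \<infinity>"
      using fatou[OF a] by (rule le_less_trans) simp
  qed simp
  have bound: "(\<integral>\<omega>. \<bar>f a \<omega> - L \<omega>\<bar>\<^sup>2 \<partial>M) \<le> (1/4)^n" if a: "0 < a" "a < d n" for a n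
    using fatou[OF a] by (simp add: nn_integral_eq_integral[OF intL[OF a]])
  \<comment> \<open>Any width below \<open>d 0\<close> serves: \<open>L\<close> is then
    \<open>f a\<close> minus a square-integrable difference.\<close>
  define a where "a = e 0"
  have a: "0 < a" "a < d 0" using e0 ed by (simp_all add: a_def)
  have "integrable M (\<lambda>\<omega>. (L \<omega>)\<^sup>2)"
  proof (rule Bochner_Integration.integrable_bound)
    show "integrable M (\<lambda>\<omega>. 2 * (f a \<omega>)\<^sup>2 + 2 * (f a \<omega> - L \<omega>)\<^sup>2)"
      by (intro Bochner_Integration.integrable_add integrable_mult_right int2[OF a(1)] intL[OF a])
    show "(\<lambda>\<omega>. (L \<omega>)\<^sup>2) \<in> borel_measurable M"
      by measurable
    have "b\<^sup>2 \<le> 2 * a\<^sup>2 + 2 * (a - b)\<^sup>2" for a b :: real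
      using zero_le_power2[of "2 * a - b"] by (simp add: power2_eq_square algebra_simps)
    then show "AE \<omega> in M. norm ((L \<omega>)\<^sup>2) \<le> norm (2 * (f a \<omega>)\<^sup>2 + 2 * (f a \<omega> - L \<omega>)\<^sup>2)"
      by simp
  qed
  then have "square_integrable M L"
    by (simp add: square_integrable_def)
  moreover have "((\<lambda>e. \<integral>\<omega>. \<bar>f e \<omega> - L \<omega>\<bar>\<^sup>2 \<partial>M) \<longlongrightarrow> 0) (at_right 0)"
  proof (rule tendstoI)
    fix \<eta> :: real assume "0 < \<eta>"
    then obtain n where n: "(1/4::real)^n < \<eta>"
      using real_arch_pow_inv[of \<eta> "1/4"] by auto
    show "\<forall>\<^sub>F a in at_right 0. dist (\<integral>\<omega>. \<bar>f a \<omega> - L \<omega>\<bar>\<^sup>2 \<partial>M) 0 < \<eta>"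
      using eventually_at_right_less[of 0] eventually_at_right_real[OF d0[of n]]
    proof eventually_elim
      case (elim a)
      then have "(\<integral>\<omega>. \<bar>f a \<omega> - L \<omega>\<bar>\<^sup>2 \<partial>M) \<le> (1/4)^n" by (intro bound) auto
      moreover have "0 \<le> (\<integral>\<omega>. \<bar>f a \<omega> - L \<omega>\<bar>\<^sup>2 \<partial>M)" by simp
      ultimately show ?case using n by (simp only: dist_real_def)
    qed
  qed
  ultimately show ?thesis by blast
qed

section \<open>Pathwise variation of constants\<close>

lemma abs_exp_minus_one_minus_le:
  fixes d :: real
  assumes "\<bar>d\<bar> \<le> 1"
  shows "\<bar>exp d - 1 - d\<bar> \<le> d\<^sup>2"
proof -
  have "exp d \<le> 1 + d + d\<^sup>2"
  proof (cases "0 \<le> d")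
    case True
    then show ?thesis using exp_bound[of d] assms by simp
  next
    case False
    have "1 - d \<le> exp (- d)" using exp_ge_add_one_self[of "- d"] by simp
    then have "exp d \<le> 1 / (1 - d)"
      using False by (simp add: exp_minus field_simps)
    \<comment> \<open>The product is \<open>1 - d^3\<close>, and \<open>d\<close> is negative in
      this case.\<close>
    also have "1 \<le> (1 + d + d\<^sup>2) * (1 - d)"
    proof -
      have "d * d\<^sup>2 \<le> 0" using False by (intro mult_nonpos_nonneg) auto
      then show ?thesis by (simp add: power2_eq_square algebra_simps)
    qed
    then have "1 / (1 - d) \<le> 1 + d + d\<^sup>2"
      using False by (simp add: field_simps)
    finally show ?thesis .
  qed
  then show ?thesis
    using exp_ge_add_one_self[of d] zero_le_power2[of d] by linarith
qed

lemma abs_integral_le_bound: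
  fixes f :: "real \<Rightarrow> real"
  assumes "p \<le> q" "f integrable_on {p..q}" "\<And>u. u \<in> {p..q} \<Longrightarrow> \<bar>f u\<bar> \<le> B"
  shows "\<bar>integral {p..q} f\<bar> \<le> B * (q - p)"
proof -
  have "0 \<le> B" using assms(1) assms(3)[of p] by force
  then show ?thesis
    using has_integral_bound_real[of B "{}" f "integral {p..q} f" p q] assms
    by (simp add: integrable_integral)
qed

text \<open>Freezing \<open>x\<close> at the right endpoint turns the drift integral into
  \<open>d * x q\<close>, where \<open>d\<close> is the integral of \<alpha>, and
  \<open>exp d\<close> differs from \<open>1 + d\<close> by at most the square of \<open>d\<close>.
  The first term of the bound is this remainder, the second the cost of freezing. Summed over n
  cells of length of order 1/n, the first vanishes and the second is controlled by the oscillation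
  \<open>\<eta>\<close>.\<close>

lemma linear_ode_step_error:
  fixes \<alpha> x w :: "real \<Rightarrow> real"
  assumes pq: "p \<le> q" and B: "\<And>u. u \<in> {p..q} \<Longrightarrow> \<bar>\<alpha> u\<bar> \<le> B"
    and int: "\<alpha> integrable_on {p..q}" "(\<lambda>u. \<alpha> u * x u) integrable_on {p..q}"
    and osc: "\<And>u. u \<in> {p..q} \<Longrightarrow> \<bar>x q - x u\<bar> \<le> \<eta>" and S: "\<bar>x q\<bar> \<le> S"
    and eq: "x q - x p = - integral {p..q} (\<lambda>u. \<alpha> u * x u) + (w q - w p)"
    and small: "B * (q - p) \<le> 1"
  shows "\<bar>exp (integral {p..q} \<alpha>) * x q - x p - (w q - w p)\<bar> \<le> S * (B * (q - p))\<^sup>2 + B * (q - p) * \<eta>"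
proof -
  define d where "d = integral {p..q} \<alpha>"
  have B0: "0 \<le> B" using B[of p] pq by force
  have dB: "\<bar>d\<bar> \<le> B * (q - p)"
    unfolding d_def by (rule abs_integral_le_bound[OF pq int(1) B])
  have I: "(\<lambda>u. \<alpha> u * (x q - x u)) integrable_on {p..q}"
    "integral {p..q} (\<lambda>u. \<alpha> u * (x q - x u)) = d * x q - integral {p..q} (\<lambda>u. \<alpha> u * x u)"
    using integrable_diff[OF integrable_on_mult_left[OF int(1), of "x q"] int(2)]
      Henstock_Kurzweil_Integration.integral_diff[OF integrable_on_mult_left[OF int(1), of "x q"] int(2)]
    by (simp_all add: right_diff_distrib d_def)
  have IB: "\<bar>integral {p..q} (\<lambda>u. \<alpha> u * (x q - x u))\<bar> \<le> (B * \<eta>) * (q - p)"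
  proof -
    have "\<bar>\<alpha> u * (x q - x u)\<bar> \<le> B * \<eta>" if "u \<in> {p..q}" for u
      unfolding abs_mult using B[OF that] osc[OF that] B0 by (intro mult_mono) auto
    then show ?thesis by (rule abs_integral_le_bound[OF pq I(1)])
  qed
  have "exp d * x q - x p - (w q - w p) =
      (exp d - 1 - d) * x q + integral {p..q} (\<lambda>u. \<alpha> u * (x q - x u))"
    using eq I(2) by (simp add: algebra_simps)
  also have "\<bar>\<dots>\<bar> \<le> \<bar>exp d - 1 - d\<bar> * \<bar>x q\<bar> + \<bar>integral {p..q} (\<lambda>u. \<alpha> u * (x q - x u))\<bar>"
    using abs_triangle_ineq by (simp add: abs_mult[symmetric])
  also have "\<dots> \<le> (B * (q - p))\<^sup>2 * S + B * \<eta> * (q - p)"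
  proof (intro add_mono mult_mono IB S)
    have "\<bar>exp d - 1 - d\<bar> \<le> d\<^sup>2"
      using dB small by (intro abs_exp_minus_one_minus_le) simp
    also have "\<dots> \<le> (B * (q - p))\<^sup>2"
      using dB by (metis abs_ge_zero power2_abs power_mono)
    finally show "\<bar>exp d - 1 - d\<bar> \<le> (B * (q - p))\<^sup>2" .
  qed auto
  finally show ?thesis by (simp add: d_def mult_ac)
qed

text \<open>For the drift coefficient this bounds the exponent of the integrating factor, and so
  bounds the factor from above and from below.\<close>

lemma abs_integral_diff_le:
  fixes f :: "real \<Rightarrow> real"
  assumes "f integrable_on {0..r}" "\<And>u. u \<in> {0..r} \<Longrightarrow> \<bar>f u\<bar> \<le> B" "u \<in> {0..r}"
  shows "\<bar>integral {0..u} f - integral {0..r} f\<bar> \<le> B * r"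
proof -
  have "integral {0..u} f + integral {u..r} f = integral {0..r} f"
    using assms by (intro Henstock_Kurzweil_Integration.integral_combine) auto
  then have "\<bar>integral {0..u} f - integral {0..r} f\<bar> = \<bar>integral {u..r} f\<bar>" by simp
  also have "\<dots> \<le> B * (r - u)"
    using assms by (intro abs_integral_le_bound) (auto intro: integrable_on_subinterval)
  also have "\<dots> \<le> B * r"
    using assms(2)[OF assms(3)] assms(3) by (intro mult_left_mono) auto
  finally show ?thesis .
qed

text \<open>Formally the differential of k x is k dw. In discrete form, the increments of k x over
  the cells telescope to the claimed limit, and each differs from its Riemann summand by
  \<open>k\<close> times the one-step error of \<open>linear_ode_step_error\<close>. The constant
  \<open>c\<close> and any shift of \<open>w\<close> drop out of the increments.\<close>

lemma variation_of_constants_Riemann_sum: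
  fixes \<alpha> x w :: "real \<Rightarrow> real"
  assumes sr: "0 \<le> s" "s < r" and B: "\<And>u. u \<in> {0..r} \<Longrightarrow> \<bar>\<alpha> u\<bar> \<le> B"
    and int: "\<alpha> integrable_on {0..r}" "(\<lambda>u. \<alpha> u * x u) integrable_on {0..r}"
    and cont: "continuous_on {0..r} x"
    and eq: "\<And>u. u \<in> {0..r} \<Longrightarrow> x u = c - integral {0..u} (\<lambda>u. \<alpha> u * x u) + w u"
  defines "k \<equiv> \<lambda>u. exp (integral {0..u} \<alpha> - integral {0..r} \<alpha>)"
    and "t \<equiv> \<lambda>n i. s + real i * ((r - s) / real n)"
  shows "(\<lambda>n. \<Sum>i<n. k (t n i) * (w (t n (Suc i)) - w (t n i))) \<longlonglongrightarrow> x r - k s * x s"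
proof (rule LIMSEQ_I)
  fix \<eta> :: real assume \<eta>: "0 < \<eta>"
  have B0: "0 \<le> B" using B[of r] sr by force
  have sub: "\<alpha> integrable_on {p..q}" "(\<lambda>u. \<alpha> u * x u) integrable_on {p..q}"
    if "0 \<le> p" "q \<le> r" for p q
    using that int by (auto intro: integrable_on_subinterval)
  have diffI: "integral {0..q} f - integral {0..p} f = integral {p..q} f"
    if "0 \<le> p" "p \<le> q" "q \<le> r" "f integrable_on {0..r}" for p q and f :: "real \<Rightarrow> real"
    using Henstock_Kurzweil_Integration.integral_combine[OF that(1,2)
      integrable_on_subinterval[OF that(4), of 0 q]] that by (simp add: algebra_simps)
  define K where "K = exp (B * r)"
  have kK: "k u \<le> K" if "u \<in> {0..r}" for u
    using abs_integral_diff_le[OF int(1) B that] by (simp add: k_def K_def)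
  have k0: "0 \<le> k u" for u by (simp add: k_def)
  have K0: "0 < K" by (simp add: K_def)
  have cpt: "compact (x ` {0..r})" using cont by (intro compact_continuous_image) auto
  then obtain S where S: "\<And>u. u \<in> {0..r} \<Longrightarrow> \<bar>x u\<bar> \<le> S"
    using compact_imp_bounded[OF cpt] unfolding bounded_iff by fastforce
  have S0: "0 \<le> S" using S[of r] sr by force
  \<comment> \<open>Chosen so that the freezing errors add up to at most \<open>\<eta> / 2\<close>;
    the summand 1 keeps the denominator positive even for \<open>B = 0\<close>.\<close>
  define \<zeta> where "\<zeta> = \<eta> / (2 * (K * B * (r - s) + 1))"
  have den: "0 < K * B * (r - s) + 1" using K0 B0 sr by (intro add_nonneg_pos mult_nonneg_nonneg) auto
  have \<zeta>: "0 < \<zeta>" using \<eta> den by (simp add: \<zeta>_def)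
  have "uniformly_continuous_on {0..r} x"
    using cont by (intro compact_uniformly_continuous) auto
  then obtain \<delta> where \<delta>: "0 < \<delta>"
    "\<And>u v. u \<in> {0..r} \<Longrightarrow> v \<in> {0..r} \<Longrightarrow> dist v u < \<delta> \<Longrightarrow> dist (x v) (x u) < \<zeta>"
    using \<zeta> unfolding uniformly_continuous_on_def by metis
  \<comment> \<open>Three demands on the mesh: \<open>x\<close> oscillates by less than
    \<open>\<zeta>\<close> on a cell, \<open>B\<close> times the mesh is below 1 as the expansion of
    \<open>exp\<close> requires, and the quadratic errors add up to less than
    \<open>\<eta> / 2\<close>.\<close>
  have l1: "\<forall>\<^sub>F n in sequentially. (r - s) / real n < \<delta>"
    using \<delta>(1) by (intro order_tendstoD(2)[OF lim_const_over_n])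
  have l2: "\<forall>\<^sub>F n in sequentially. (B * (r - s)) / real n < 1"
    by (intro order_tendstoD(2)[OF lim_const_over_n]) simp
  have l3: "\<forall>\<^sub>F n in sequentially. (K * S * (B * (r - s))\<^sup>2) / real n < \<eta> / 2"
    using \<eta> by (intro order_tendstoD(2)[OF lim_const_over_n]) simp
  have "\<forall>\<^sub>F n in sequentially.
      norm ((\<Sum>i<n. k (t n i) * (w (t n (Suc i)) - w (t n i))) - (x r - k s * x s)) < \<eta>"
    using l1 l2 l3 eventually_gt_at_top[of 0]
  proof eventually_elim
    case (elim n)
    define h where "h = (r - s) / real n"
    have h0: "0 < h" using sr elim by (simp add: h_def)
    have nh: "real n * h = r - s" using elim by (simp add: h_def)
    have th: "t n i = s + real i * h" for i by (simp add: t_def h_def)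
    have t0: "t n 0 = s" and tn: "t n n = r" and tS: "t n (Suc i) = t n i + h" for i
      by (simp_all add: th nh distrib_right)
    have tmem: "t n i \<in> {0..r}" if "i \<le> n" for i
    proof -
      have "real i * h \<le> real n * h" using that h0 by (intro mult_right_mono) auto
      then show ?thesis using sr h0 nh by (auto simp: th)
    qed
    have krr: "k r = 1" by (simp add: k_def)
    have tel: "x r - k s * x s = (\<Sum>i<n. k (t n (Suc i)) * x (t n (Suc i)) - k (t n i) * x (t n i))"
      using sum_lessThan_telescope[of "\<lambda>i. k (t n i) * x (t n i)" n] by (simp add: t0 tn krr)
    have step: "\<bar>k (t n i) * (w (t n (Suc i)) - w (t n i)) -
        (k (t n (Suc i)) * x (t n (Suc i)) - k (t n i) * x (t n i))\<bar>
        \<le> K * (S * (B * h)\<^sup>2 + B * h * \<zeta>)" if i: "i < n" for i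
    proof -
      let ?p = "t n i" and ?q = "t n (Suc i)"
      have p: "?p \<in> {0..r}" and q: "?q \<in> {0..r}" using tmem i by auto
      have qp: "?q - ?p = h" by (simp add: tS)
      have le: "?p \<le> ?q" using h0 by (simp add: tS)
      have kq: "k ?q = k ?p * exp (integral {?p..?q} \<alpha>)"
        using diffI[of ?p ?q \<alpha>] p q le int by (auto simp: k_def exp_add[symmetric])
      have e: "\<bar>exp (integral {?p..?q} \<alpha>) * x ?q - x ?p - (w ?q - w ?p)\<bar>
          \<le> S * (B * (?q - ?p))\<^sup>2 + B * (?q - ?p) * \<zeta>"
      proof (rule linear_ode_step_error)
        show "\<bar>x ?q - x u\<bar> \<le> \<zeta>" if "u \<in> {?p..?q}" for u
          using \<delta>(2)[of u ?q] that p q elim(1) qp by (auto simp: dist_real_def h_def)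
        show "x ?q - x ?p = - integral {?p..?q} (\<lambda>u. \<alpha> u * x u) + (w ?q - w ?p)"
          using eq[OF p] eq[OF q] diffI[of ?p ?q "\<lambda>u. \<alpha> u * x u"] p q le int by simp
        show "B * (?q - ?p) \<le> 1" using elim(2) by (simp add: qp h_def)
      qed (use B S sub p q le in auto)
      have "\<bar>k ?p * (w ?q - w ?p) - (k ?q * x ?q - k ?p * x ?p)\<bar> =
          k ?p * \<bar>exp (integral {?p..?q} \<alpha>) * x ?q - x ?p - (w ?q - w ?p)\<bar>"
      proof -
        have "k ?p * (w ?q - w ?p) - (k ?q * x ?q - k ?p * x ?p) =
            - (k ?p * (exp (integral {?p..?q} \<alpha>) * x ?q - x ?p - (w ?q - w ?p)))"
          unfolding kq by (simp add: algebra_simps)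
        then show ?thesis using k0[of ?p] by (simp only: abs_minus_cancel abs_mult abs_of_nonneg)
      qed
      also have "\<dots> \<le> K * (S * (B * h)\<^sup>2 + B * h * \<zeta>)"
        using e kK[OF p] K0 unfolding qp by (intro mult_mono) auto
      finally show ?thesis .
    qed
    have "norm ((\<Sum>i<n. k (t n i) * (w (t n (Suc i)) - w (t n i))) - (x r - k s * x s))
        \<le> (\<Sum>i<n. K * (S * (B * h)\<^sup>2 + B * h * \<zeta>))"
      unfolding tel sum_subtractf[symmetric] by (rule sum_norm_le) (use step in simp)
    also have "\<dots> = (K * S * (B * (r - s))\<^sup>2) / real n + K * B * (r - s) * \<zeta>"
      using elim by (simp add: h_def power2_eq_square field_simps)
    also have "\<dots> < \<eta> / 2 + \<eta> / 2"
    proof (rule add_less_le_mono[OF elim(3)])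
      have "K * B * (r - s) * \<zeta> \<le> (K * B * (r - s) + 1) * \<zeta>" using \<zeta> by simp
      also have "\<dots> = \<eta> / 2" using den by (simp add: \<zeta>_def del: distrib_left_numeral)
      finally show "K * B * (r - s) * \<zeta> \<le> \<eta> / 2" .
    qed
    finally show ?case by simp
  qed
  then show "\<exists>N. \<forall>n\<ge>N. norm ((\<Sum>i<n. k (t n i) * (w (t n (Suc i)) - w (t n i))) - (x r - k s * x s)) < \<eta>"
    by (simp add: eventually_sequentially)
qed

section \<open>Independence and normal laws from characteristic functions\<close>

text \<open>Translates independence of sigma-algebras, the form in which
  \<open>brownian_motion\<close> provides it, into a product rule for complex integrands. Both
  factors generate sub-sigma-algebras of independent ones, and their bounds make them
  integrable.\<close>

lemma (in prob_space) expectation_mult_indep_subalgebra: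
  fixes U :: "'a \<Rightarrow> complex" and D :: "'a \<Rightarrow> real" and h :: "real \<Rightarrow> complex"
  assumes indep: "indep_set (sets G) (sets (vimage_algebra (space M) D borel))"
    and G: "subalgebra M G" and U: "U \<in> borel_measurable G"
    and D[measurable]: "D \<in> borel_measurable M" and h[measurable]: "h \<in> borel_measurable borel"
    and bound: "\<And>\<omega>. norm (U \<omega>) \<le> 1" "\<And>y. norm (h y) \<le> 1"
  shows "expectation (\<lambda>\<omega>. U \<omega> * h (D \<omega>)) = expectation U * expectation (\<lambda>\<omega>. h (D \<omega>))"
proof (rule indep_var_lebesgue_integral)
  have UM[measurable]: "U \<in> borel_measurable M"
    using measurable_from_subalg[OF G U] .
  have sG: "space G = space M" using G by (simp add: subalgebra_def)
  have 1: "sigma_sets (space M) {U -` A \<inter> space M |A. A \<in> sets borel} \<subseteq> sets G"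
    using sets.sigma_sets_subset[of "{U -` A \<inter> space M |A. A \<in> sets borel}" G]
      measurable_sets[OF U] by (auto simp: sG)
  have 2: "sigma_sets (space M) {(\<lambda>\<omega>. h (D \<omega>)) -` A \<inter> space M |A. A \<in> sets borel}
      \<subseteq> sets (vimage_algebra (space M) D borel)"
  proof (rule sets.sigma_sets_subset[of _ "vimage_algebra (space M) D borel", simplified space_vimage_algebra], safe)
    fix A :: "complex set" assume "A \<in> sets borel"
    then have "h -` A \<in> sets borel" using measurable_sets[OF h, of A] by simp
    then have "D -` (h -` A) \<inter> space M \<in> sets (vimage_algebra (space M) D borel)"
      by (rule in_vimage_algebra)
    then show "(\<lambda>\<omega>. h (D \<omega>)) -` A \<inter> space M \<in> sets (vimage_algebra (space M) D borel)"
      by (simp add: vimage_def)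
  qed
  show "indep_var borel U borel (\<lambda>\<omega>. h (D \<omega>))"
    unfolding indep_var_eq
  proof (intro conjI)
    show "indep_set (sigma_sets (space M) {U -` A \<inter> space M |A. A \<in> sets borel})
        (sigma_sets (space M) {(\<lambda>\<omega>. h (D \<omega>)) -` A \<inter> space M |A. A \<in> sets borel})"
      using indep unfolding indep_set_def
      by (rule indep_sets_mono_sets) (use 1 2 in \<open>auto split: bool.split\<close>)
  qed measurable
  show "integrable M U" by (rule integrable_const_bound[of _ 1]) (use bound in auto)
  show "integrable M (\<lambda>\<omega>. h (D \<omega>))" by (rule integrable_const_bound[of _ 1]) (use bound in auto)
qed

lemma (in prob_space) expectation_iexp_normal:
  assumes D: "distributed M lborel D (normal_density 0 \<sigma>)" and \<sigma>: "0 < \<sigma>"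
  shows "expectation (\<lambda>\<omega>. iexp (\<theta> * D \<omega>)) = complex_of_real (exp (- ((\<theta> * \<sigma>)\<^sup>2 / 2)))"
proof -
  have std: "distributed M lborel (\<lambda>x. (D x - 0) / \<sigma>) std_normal_density"
    using D normal_standard_normal_convert[OF \<sigma>] by blast
  have [measurable]: "D \<in> borel_measurable M"
    using distributed_measurable[OF D] by simp
  have "complex_of_real (exp (- ((\<theta> * \<sigma>)\<^sup>2 / 2))) = char std_normal_distribution (\<theta> * \<sigma>)"
    by (simp add: char_std_normal_distribution)
  also have "std_normal_distribution = distr M lborel (\<lambda>x. (D x - 0) / \<sigma>)"
    using distributed_distr_eq_density[OF std] by simp
  also have "char \<dots> (\<theta> * \<sigma>) = expectation (\<lambda>\<omega>. iexp (\<theta> * \<sigma> * ((D \<omega> - 0) / \<sigma>)))"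
    unfolding char_def by (rule integral_distr) measurable
  also have "\<dots> = expectation (\<lambda>\<omega>. iexp (\<theta> * D \<omega>))"
    using \<sigma> by (intro Bochner_Integration.integral_cong) auto
  finally show ?thesis ..
qed

lemma real_distribution_normal: "0 < \<sigma> \<Longrightarrow> real_distribution (density lborel (normal_density \<mu> \<sigma>))"
  by (auto simp: real_distribution_def real_distribution_axioms_def prob_space_normal_density)

lemma char_normal:
  assumes "0 < \<sigma>"
  shows "char (density lborel (normal_density 0 \<sigma>)) \<theta> = complex_of_real (exp (- ((\<theta> * \<sigma>)\<^sup>2 / 2)))"
proof -
  interpret N: prob_space "density lborel (normal_density 0 \<sigma>)"
    using assms by (rule prob_space_normal_density)
  have "distributed (density lborel (normal_density 0 \<sigma>)) lborel (\<lambda>x. x) (normal_density 0 \<sigma>)"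
    unfolding distributed_def by (auto intro!: measure_eqI simp: emeasure_distr)
  from N.expectation_iexp_normal[OF this assms] show ?thesis
    by (simp add: char_def)
qed

text \<open>Divided by \<open>prob A\<close>, the hypothesis says that conditionally on any event of
  \<open>G\<close> of positive probability \<open>Z\<close> has the same normal characteristic
  function. By Levy's uniqueness theorem the conditional law does not depend on the event, which is
  independence; the event \<open>space M\<close> gives the law itself.\<close>

lemma (in prob_space) normal_indep_subalgebra_if_char:
  fixes U Z :: "'a \<Rightarrow> real"
  assumes G: "subalgebra M G" and Z[measurable]: "Z \<in> borel_measurable M" and v: "0 < v"
    and char: "\<And>A \<theta>. A \<in> sets G \<Longrightarrow>
      expectation (\<lambda>\<omega>. indicator A \<omega> * iexp (\<theta> * Z \<omega>)) = complex_of_real (prob A * exp (- (\<theta>\<^sup>2 * v / 2)))"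
  shows "distributed M lborel Z (normal_density 0 (sqrt v))" (is ?dist)
    and "U \<in> borel_measurable G \<Longrightarrow> indep_var borel U borel Z"
proof -
  define N where "N = density lborel (\<lambda>x. ennreal (normal_density 0 (sqrt v) x))"
  interpret N: real_distribution N
    unfolding N_def using v by (intro real_distribution_normal) simp
  have sG: "space G = space M" "sets G \<subseteq> sets M" using G by (simp_all add: subalgebra_def)
  have key: "prob (A \<inter> (Z -` B \<inter> space M)) = prob A * measure N B"
    if A: "A \<in> sets G" and B[measurable]: "B \<in> sets borel" for A B
  proof (cases "prob A = 0")
    case True
    have "prob (A \<inter> (Z -` B \<inter> space M)) \<le> prob A"
      using A sG by (intro finite_measure_mono) auto
    with True show ?thesis by (simp add: measure_le_0_iff)
  next
    case False
    then have pA: "0 < prob A" using measure_nonneg[of M A] by linarith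
    have [measurable]: "A \<in> sets M" using A sG by auto
    \<comment> \<open>The conditional probability given \<open>A\<close>; events of probability 0
      were split off because of the division.\<close>
    define MA where "MA = density M (\<lambda>\<omega>. ennreal (indicator A \<omega> / prob A))"
    have em: "emeasure MA C = ennreal (prob (A \<inter> C) / prob A)" if [measurable]: "C \<in> sets M" for C
    proof -
      have "emeasure MA C = (\<integral>\<^sup>+\<omega>. ennreal (1 / prob A) * indicator (A \<inter> C) \<omega> \<partial>M)"
        unfolding MA_def by (subst emeasure_density) (auto intro!: nn_integral_cong split: split_indicator)
      also have "\<dots> = ennreal (1 / prob A) * ennreal (prob (A \<inter> C))"
        by (simp add: nn_integral_cmult emeasure_eq_measure)
      also have "\<dots> = ennreal (prob (A \<inter> C) / prob A)"
        by (subst ennreal_mult[symmetric]) auto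
      finally show ?thesis .
    qed
    interpret MA: prob_space MA
    proof
      have "A \<inter> space M = A" using A sG sets.sets_into_space[of A M] by auto
      then show "emeasure MA (space MA) = 1"
        using em[of "space M"] pA by (simp add: MA_def)
    qed
    have [measurable]: "Z \<in> borel_measurable MA" by (simp add: MA_def)
    have "distr MA borel Z = N"
    proof (rule Levy_uniqueness)
      show "real_distribution (distr MA borel Z)" by (rule MA.real_distribution_distr) simp
      show "real_distribution N" ..
      show "Characteristic_Functions.char (distr MA borel Z) = Characteristic_Functions.char N"
      proof
        fix \<theta>
        have "Characteristic_Functions.char (distr MA borel Z) \<theta> = (\<integral>\<omega>. iexp (\<theta> * Z \<omega>) \<partial>MA)"
          unfolding char_def by (rule integral_distr) measurable
        also have "\<dots> = (\<integral>\<omega>. (indicator A \<omega> / prob A) *\<^sub>R iexp (\<theta> * Z \<omega>) \<partial>M)"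
          unfolding MA_def by (rule integral_density) auto
        also have "\<dots> = (\<integral>\<omega>. (1 / prob A) *\<^sub>R (indicator A \<omega> * iexp (\<theta> * Z \<omega>)) \<partial>M)"
          by (intro Bochner_Integration.integral_cong) (auto simp: scaleR_conv_of_real split: split_indicator)
        also have "\<dots> = (1 / prob A) *\<^sub>R complex_of_real (prob A * exp (- (\<theta>\<^sup>2 * v / 2)))"
          using char[OF A, of \<theta>] by (subst integral_scaleR_right) simp
        also have "\<dots> = complex_of_real (exp (- ((\<theta> * sqrt v)\<^sup>2 / 2)))"
          using pA v by (simp add: scaleR_conv_of_real power_mult_distrib)
        also have "\<dots> = Characteristic_Functions.char N \<theta>"
          unfolding N_def using v by (subst char_normal) auto
        finally show "Characteristic_Functions.char (distr MA borel Z) \<theta> = Characteristic_Functions.char N \<theta>" .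
      qed
    qed
    then have "emeasure N B = emeasure (distr MA borel Z) B" by simp
    also have "\<dots> = emeasure MA (Z -` B \<inter> space M)"
      by (subst emeasure_distr) (auto simp: MA_def)
    also have "\<dots> = ennreal (prob (A \<inter> (Z -` B \<inter> space M)) / prob A)"
      by (rule em) measurable
    finally have "measure N B = prob (A \<inter> (Z -` B \<inter> space M)) / prob A"
      using pA by (simp add: N.emeasure_eq_measure)
    then show ?thesis using pA by simp
  qed
  have key1: "prob (Z -` B \<inter> space M) = measure N B" if "B \<in> sets borel" for B
    using key[of "space M" B] that sets.top[of G] sG by (simp add: prob_space Int_absorb1)
  show ?dist
    unfolding distributed_def
  proof (intro conjI)
    show "distr M lborel Z = density lborel (\<lambda>x. ennreal (normal_density 0 (sqrt v) x))"
    proof (rule measure_eqI)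
      fix B assume "B \<in> sets (distr M lborel Z)"
      then have B: "B \<in> sets borel" by simp
      then show "emeasure (distr M lborel Z) B = emeasure (density lborel (\<lambda>x. ennreal (normal_density 0 (sqrt v) x))) B"
        using key1[OF B] N.emeasure_eq_measure[of B]
        by (simp add: emeasure_distr emeasure_eq_measure N_def)
    qed simp
  qed measurable
  show "indep_var borel U borel Z" if U: "U \<in> borel_measurable G"
  proof -
    have UM: "U \<in> borel_measurable M" using measurable_from_subalg[OF G U] .
    have stable: "Int_stable {f -` A \<inter> space M |A. A \<in> sets borel}" for f :: "'a \<Rightarrow> real"
      unfolding Int_stable_def
    proof safe
      fix A B :: "real set" assume "A \<in> sets borel" "B \<in> sets borel"
      then show "\<exists>C. f -` A \<inter> space M \<inter> (f -` B \<inter> space M) = f -` C \<inter> space M \<and> C \<in> sets borel"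
        by (intro exI[of _ "A \<inter> B"]) auto
    qed
    have "indep_set {U -` A \<inter> space M |A. A \<in> sets borel} {Z -` A \<inter> space M |A. A \<in> sets borel}"
    proof (rule indep_setI)
      show "{U -` A \<inter> space M |A. A \<in> sets borel} \<subseteq> events"
        using measurable_sets[OF UM] by auto
      show "{Z -` A \<inter> space M |A. A \<in> sets borel} \<subseteq> events"
        using measurable_sets[OF Z] by auto
      fix a b assume a: "a \<in> {U -` A \<inter> space M |A. A \<in> sets borel}"
        and b: "b \<in> {Z -` A \<inter> space M |A. A \<in> sets borel}"
      obtain A B where AB: "A \<in> sets borel" "a = U -` A \<inter> space M"
          "B \<in> sets borel" "b = Z -` B \<inter> space M"
        using a b by (elim CollectE exE conjE) (rule that)
      have "a \<in> sets G" using measurable_sets[OF U AB(1)] AB(2) sG by simp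
      from key[OF this AB(3)] key1[OF AB(3)] show "prob (a \<inter> b) = prob a * prob b"
        by (simp add: AB(4))
    qed
    then show ?thesis
      unfolding indep_var_eq using UM Z by (auto intro!: indep_set_sigma_sets stable)
  qed
qed

section \<open>Gaussian transitions and marginals of the solution\<close>

context complete_filtered_prob_space
begin

lemma brownian_increment_measurable:
  assumes "brownian_motion M F W" "0 \<le> s" "s < t"
  shows "(\<lambda>\<omega>. W t \<omega> - W s \<omega>) \<in> borel_measurable M"
proof -
  have "distributed M lborel (\<lambda>\<omega>. W t \<omega> - W s \<omega>) (normal_density 0 (sqrt (t - s)))"
    using assms by (simp add: brownian_motion_def)
  from distributed_measurable[OF this] show ?thesis by simp
qed

lemma borel_measurable_F_mono:
  assumes "f \<in> borel_measurable (F s)" "0 \<le> s" "s \<le> t"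
  shows "f \<in> borel_measurable (F t)"
proof (rule measurable_from_subalg[OF _ assms(1)])
  show "subalgebra (F t) (F s)"
    using subalg[of s] subalg[of t] F_mono[of s t] assms by (simp add: subalgebra_def)
qed

text \<open>Induction that peels off the last increment: the indicator of \<open>A\<close> and the
  earlier increments are measurable with respect to \<open>F (u n)\<close>, of which the last
  increment is independent, so each step contributes one more Gaussian factor. The grid increases
  strictly on all of the natural numbers, which frees the induction from an upper index; the uniform
  grid used later simply continues beyond \<open>r\<close>.\<close>

lemma expectation_iexp_brownian_sum:
  assumes BM: "brownian_motion M F W"
    and u: "0 \<le> u 0" "\<And>i. u i < u (Suc i)" and A: "A \<in> sets (F (u 0))"
  shows "expectation (\<lambda>\<omega>. indicator A \<omega> * iexp (\<theta> * (\<Sum>i<n. c i * (W (u (Suc i)) \<omega> - W (u i) \<omega>)))) =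
    complex_of_real (prob A * exp (- (\<theta>\<^sup>2 * (\<Sum>i<n. (c i)\<^sup>2 * (u (Suc i) - u i)) / 2)))"
proof (induction n)
  case 0
  have "A \<in> sets M" using A subalg[OF u(1)] by (auto simp: subalgebra_def)
  then have "expectation (\<lambda>\<omega>. complex_of_real (indicator A \<omega>)) = complex_of_real (prob A)"
    by (subst integral_complex_of_real) simp
  then show ?case by (simp add: of_real_indicator)
next
  case (Suc n)
  have mono: "u i \<le> u j" if "i \<le> j" for i j
    by (rule lift_Suc_mono_le[of u, OF less_imp_le[OF u(2)] that])
  have u0: "0 \<le> u i" for i using mono[of 0 i] u(1) by simp
  let ?S = "\<lambda>\<omega>. \<Sum>i<n. c i * (W (u (Suc i)) \<omega> - W (u i) \<omega>)"
  let ?D = "\<lambda>\<omega>. W (u (Suc n)) \<omega> - W (u n) \<omega>"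
  let ?U = "\<lambda>\<omega>. indicator A \<omega> * iexp (\<theta> * ?S \<omega>)"
  have WF: "W (u i) \<in> borel_measurable (F (u j))" if "i \<le> j" for i j
  proof (rule borel_measurable_F_mono)
    show "W (u i) \<in> borel_measurable (F (u i))"
      using BM u0[of i] by (simp add: brownian_motion_def adapted_def)
  qed (use u0 mono that in auto)
  have [measurable]: "W (u i) \<in> borel_measurable (F (u n))" if "i \<le> n" for i
    using WF that by auto
  have [measurable]: "A \<in> sets (F (u n))" using A F_mono[OF u(1) mono[of 0 n]] by auto
  have S[measurable]: "?S \<in> borel_measurable (F (u n))"
    by (intro borel_measurable_sum borel_measurable_times borel_measurable_diff) (auto intro: WF)
  have inc: "indep_set (sets (F (u n))) (sets (vimage_algebra (space M) ?D borel))"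
    and dist: "distributed M lborel ?D (normal_density 0 (sqrt (u (Suc n) - u n)))"
    using BM u0[of n] u(2)[of n] by (simp_all add: brownian_motion_def)
  have "expectation (\<lambda>\<omega>. ?U \<omega> * iexp ((\<theta> * c n) * ?D \<omega>)) =
      expectation ?U * expectation (\<lambda>\<omega>. iexp ((\<theta> * c n) * ?D \<omega>))"
  proof (rule expectation_mult_indep_subalgebra[OF inc subalg[OF u0], where h="\<lambda>y. iexp (\<theta> * c n * y)"])
    show "?D \<in> borel_measurable M" by (rule brownian_increment_measurable[OF BM u0 u(2)])
    show "cmod (?U \<omega>) \<le> 1" for \<omega>
      by (auto simp: norm_mult split: split_indicator simp del: of_real_mult of_real_sum)
    show "cmod (iexp (\<theta> * c n * y)) \<le> 1" for y by (simp del: of_real_mult)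
  qed measurable
  also have "expectation (\<lambda>\<omega>. iexp ((\<theta> * c n) * ?D \<omega>)) =
      complex_of_real (exp (- ((\<theta> * c n * sqrt (u (Suc n) - u n))\<^sup>2 / 2)))"
    using u(2)[of n] by (intro expectation_iexp_normal[OF dist]) simp
  also have "(\<theta> * c n * sqrt (u (Suc n) - u n))\<^sup>2 = \<theta>\<^sup>2 * ((c n)\<^sup>2 * (u (Suc n) - u n))"
    using u(2)[of n] by (simp add: power_mult_distrib)
  also note Suc.IH
  finally show ?case
    by (simp add: exp_add[symmetric] algebra_simps add_divide_distrib diff_divide_distrib flip: of_real_exp of_real_mult)
qed

text \<open>The witness for \<open>a\<close> is the integrating factor from \<open>s\<close> to
  \<open>r\<close>, the exponential of minus the integral of \<alpha> over [s, r]. Its value is left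
  open because the later bounds hold uniformly in \<open>a\<close>, and the limits only have to
  agree for a given \<open>a\<close>. The lower bound for \<open>v\<close> is what makes the
  singularity on the diagonal integrable.\<close>

lemma sde_transition:
  assumes BM: "brownian_motion M F W"
    and \<alpha>: "\<alpha> \<in> borel_measurable (lebesgue_on {0..})"
    and sde: "sde_solution M F W \<alpha> X"
    and sr: "0 \<le> s" "s < r" and B: "\<And>u. u \<in> {0..r} \<Longrightarrow> \<bar>\<alpha> u\<bar> \<le> B"
  obtains a v where "exp (- (2 * B * r)) * (r - s) \<le> v"
    "distributed M lborel (\<lambda>\<omega>. X r \<omega> - a * X s \<omega>) (normal_density 0 (sqrt v))"
    "indep_var borel (X s) borel (\<lambda>\<omega>. X r \<omega> - a * X s \<omega>)"
proof -
  have XF: "X u \<in> borel_measurable (F u)" if "0 \<le> u" for u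
    using sde that by (simp add: sde_solution_def adapted_def)
  have WF: "W u \<in> borel_measurable (F u)" if "0 \<le> u" for u
    using BM that by (simp add: brownian_motion_def adapted_def)
  have XM: "X u \<in> borel_measurable M" and WM: "W u \<in> borel_measurable M" if "0 \<le> u" for u
    using measurable_from_subalg[OF subalg XF] measurable_from_subalg[OF subalg WF] that by auto
  have int: "\<alpha> integrable_on {0..r}"
  proof (rule measurable_bounded_by_integrable_imp_integrable)
    show "\<alpha> \<in> borel_measurable (lebesgue_on {0..r})"
      by (rule measurable_restrict_mono[OF \<alpha>]) auto
    show "(\<lambda>_. B) integrable_on {0..r}" by (rule integrable_const_ivl)
  qed (use B in auto)
  define k where "k u = exp (integral {0..u} \<alpha> - integral {0..r} \<alpha>)" for u
  define t where "t n i = s + real i * ((r - s) / real n)" for n i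
  define S where "S n \<omega> = (\<Sum>i<n. k (t n i) * (W (t n (Suc i)) \<omega> - W (t n i) \<omega>))" for n \<omega>
  define Z where "Z \<omega> = X r \<omega> - k s * X s \<omega>" for \<omega>
  have t0: "t n 0 = s" "0 \<le> t n i" for n i using sr by (simp_all add: t_def)
  have tS: "t n (Suc i) - t n i = (r - s) / real n" for n i
    unfolding t_def of_nat_Suc by (simp only: distrib_right)
  have S_lim: "AE \<omega> in M. (\<lambda>n. S n \<omega>) \<longlonglongrightarrow> Z \<omega>"
  proof -
    have "AE \<omega> in M. continuous_on {0..} (\<lambda>t. X t \<omega>)"
      using sde by (simp add: sde_solution_def continuous_paths_def)
    moreover have "AE \<omega> in M. \<forall>t\<ge>0.
        set_integrable lebesgue {0..t} (\<lambda>s. \<alpha> s * X s \<omega>) \<and>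
        X t \<omega> = X 0 \<omega> - (LINT s:{0..t}|lebesgue. \<alpha> s * X s \<omega>) + (W t \<omega> - W 0 \<omega>)"
      using sde by (simp add: sde_solution_def)
    ultimately show ?thesis
    proof eventually_elim
      case (elim \<omega>)
      have "(\<lambda>n. \<Sum>i<n. k (t n i) * ((W (t n (Suc i)) \<omega> - W 0 \<omega>) - (W (t n i) \<omega> - W 0 \<omega>)))
          \<longlonglongrightarrow> X r \<omega> - k s * X s \<omega>"
        unfolding k_def t_def
      proof (rule variation_of_constants_Riemann_sum[OF sr B int, where x="\<lambda>u. X u \<omega>"
            and c="X 0 \<omega>" and w="\<lambda>u. W u \<omega> - W 0 \<omega>"])
        show "(\<lambda>u. \<alpha> u * X u \<omega>) integrable_on {0..r}"
        proof (rule set_lebesgue_integral_eq_integral(1))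
          show "set_integrable lebesgue {0..r} (\<lambda>u. \<alpha> u * X u \<omega>)"
            using elim(2) sr by simp
        qed
        show "continuous_on {0..r} (\<lambda>u. X u \<omega>)"
          using elim(1) by (rule continuous_on_subset) auto
        show "X u \<omega> = X 0 \<omega> - integral {0..u} (\<lambda>u. \<alpha> u * X u \<omega>) + (W u \<omega> - W 0 \<omega>)"
          if "u \<in> {0..r}" for u
        proof -
          have "0 \<le> u" using that by simp
          with elim(2) have "set_integrable lebesgue {0..u} (\<lambda>s. \<alpha> s * X s \<omega>)"
            and "X u \<omega> = X 0 \<omega> - (LINT s:{0..u}|lebesgue. \<alpha> s * X s \<omega>) + (W u \<omega> - W 0 \<omega>)"
            by blast+
          then show ?thesis
            by (simp only: set_lebesgue_integral_eq_integral(2))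
        qed
      qed
      then show ?case by (simp add: S_def Z_def)
    qed
  qed
  \<comment> \<open>The variance of the normal variable \<open>S n\<close>.\<close>
  define v where "v n = (\<Sum>i<n. (k (t n i))\<^sup>2 * (t n (Suc i) - t n i))" for n
  have kb: "exp (- (2 * B * r)) \<le> (k u)\<^sup>2" "(k u)\<^sup>2 \<le> exp (2 * B * r)" if "u \<in> {0..r}" for u
  proof -
    have "(k u)\<^sup>2 = exp (2 * (integral {0..u} \<alpha> - integral {0..r} \<alpha>))"
      by (simp add: k_def power2_eq_square exp_add[symmetric])
    then show "exp (- (2 * B * r)) \<le> (k u)\<^sup>2" "(k u)\<^sup>2 \<le> exp (2 * B * r)"
      using abs_integral_diff_le[OF int B that] by (simp_all add: abs_le_iff)
  qed
  \<comment> \<open>Index 0 is left out: \<open>v 0\<close> is an empty sum and lies below the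
    positive lower bound.\<close>
  have vb: "v (Suc n) \<in> {exp (- (2 * B * r)) * (r - s)..exp (2 * B * r) * (r - s)}" for n
  proof -
    define h where "h = (r - s) / real (Suc n)"
    have h: "0 \<le> h" "real (Suc n) * h = r - s" using sr by (simp_all add: h_def)
    have mem: "t (Suc n) i \<in> {0..r}" if "i < Suc n" for i
    proof -
      have "real i * h \<le> real (Suc n) * h" using that h by (intro mult_right_mono) auto
      then show ?thesis using h sr t0(2)[of "Suc n" i] unfolding t_def h_def[symmetric] by auto
    qed
    have v: "v (Suc n) = (\<Sum>i<Suc n. (k (t (Suc n) i))\<^sup>2 * h)"
      unfolding v_def tS h_def ..
    have "(\<Sum>i<Suc n. exp (- (2 * B * r)) * h) \<le> v (Suc n)"
      unfolding v by (intro sum_mono mult_right_mono kb mem h) auto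
    moreover have "v (Suc n) \<le> (\<Sum>i<Suc n. exp (2 * B * r) * h)"
      unfolding v by (intro sum_mono mult_right_mono kb mem h) auto
    moreover have "(\<Sum>i<Suc n. c * h) = c * (r - s)" for c
      unfolding sum_constant card_lessThan mult.left_commute[of _ c h] h(2) ..
    ultimately show ?thesis by (simp only: atLeastAtMost_iff)
  qed
  (* A cluster point of the variances suffices, so their limit need not be identified. *)
  then obtain l \<phi> where l: "l \<in> {exp (- (2 * B * r)) * (r - s)..exp (2 * B * r) * (r - s)}"
    and \<phi>: "strict_mono \<phi>" "((\<lambda>n. v (Suc n)) \<circ> \<phi>) \<longlonglongrightarrow> l"
    using seq_compactE[OF compact_imp_seq_compact[OF compact_Icc], of "\<lambda>n. v (Suc n)"]
    by metis
  \<comment> \<open>The limiting normal law must be nondegenerate for the uniqueness argument; the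
    uniform lower bound on the variances survives passage to the cluster point.\<close>
  have l0: "0 < l"
  proof -
    have "0 < exp (- (2 * B * r)) * (r - s)" using sr by simp
    then show ?thesis using l by simp
  qed
  have [measurable]: "W (t n i) \<in> borel_measurable M" for n i by (rule WM[OF t0(2)])
  have Sm[measurable]: "S n \<in> borel_measurable M" for n unfolding S_def by measurable
  have [measurable]: "X s \<in> borel_measurable M" "X r \<in> borel_measurable M" using XM sr by auto
  have Zm[measurable]: "Z \<in> borel_measurable M" unfolding Z_def by measurable
  \<comment> \<open>Two limits of one sequence are compared: dominated convergence along almost
    every path, with dominating constant 1, and convergence of the explicit Gaussian values along
    the subsequence chosen for the variances.\<close>
  have char: "expectation (\<lambda>\<omega>. indicator A \<omega> * iexp (\<theta> * Z \<omega>)) =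
      complex_of_real (prob A * exp (- (\<theta>\<^sup>2 * l / 2)))" if A: "A \<in> sets (F s)" for A \<theta>
  proof (rule LIMSEQ_unique)
    have [measurable]: "A \<in> sets M" using A subalg[OF sr(1)] by (auto simp: subalgebra_def)
    show "(\<lambda>n. expectation (\<lambda>\<omega>. indicator A \<omega> * iexp (\<theta> * S (Suc (\<phi> n)) \<omega>)))
        \<longlonglongrightarrow> expectation (\<lambda>\<omega>. indicator A \<omega> * iexp (\<theta> * Z \<omega>))"
    proof (rule integral_dominated_convergence[where w="\<lambda>_. 1"])
      show "AE \<omega> in M. (\<lambda>n. indicator A \<omega> * iexp (\<theta> * S (Suc (\<phi> n)) \<omega>)) \<longlonglongrightarrow> indicator A \<omega> * iexp (\<theta> * Z \<omega>)"
        using S_lim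
      proof eventually_elim
        case (elim \<omega>)
        have "strict_mono (\<lambda>n. Suc (\<phi> n))" using \<phi>(1) by (simp add: strict_mono_def)
        from LIMSEQ_subseq_LIMSEQ[OF elim this]
        have "(\<lambda>n. S (Suc (\<phi> n)) \<omega>) \<longlonglongrightarrow> Z \<omega>" by (simp add: comp_def)
        then show ?case by (intro tendsto_intros)
      qed
      show "AE \<omega> in M. norm (indicator A \<omega> * iexp (\<theta> * S (Suc (\<phi> n)) \<omega>)) \<le> 1" for n
        by (auto simp: norm_mult split: split_indicator simp del: of_real_mult)
    qed auto
    have eq: "expectation (\<lambda>\<omega>. indicator A \<omega> * iexp (\<theta> * S (Suc m) \<omega>)) =
        complex_of_real (prob A * exp (- (\<theta>\<^sup>2 * v (Suc m) / 2)))" for m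
      unfolding S_def v_def
    proof (rule expectation_iexp_brownian_sum[OF BM, where u="t (Suc m)"])
      show "t (Suc m) i < t (Suc m) (Suc i)" for i
      proof -
        have "0 < (r - s) / real (Suc m)" using sr by simp
        then show ?thesis using tS[of "Suc m" i] by linarith
      qed
    qed (use A t0 sr in auto)
    show "(\<lambda>n. expectation (\<lambda>\<omega>. indicator A \<omega> * iexp (\<theta> * S (Suc (\<phi> n)) \<omega>)))
        \<longlonglongrightarrow> complex_of_real (prob A * exp (- (\<theta>\<^sup>2 * l / 2)))"
      unfolding eq using \<phi>(2) by (intro tendsto_intros) (simp_all add: comp_def)
  qed
  show ?thesis
  proof (rule that)
    show "exp (- (2 * B * r)) * (r - s) \<le> l" using l by simp
    show "distributed M lborel (\<lambda>\<omega>. X r \<omega> - k s * X s \<omega>) (normal_density 0 (sqrt l))"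
      using normal_indep_subalgebra_if_char(1)[OF subalg[OF sr(1)] Zm l0 char] unfolding Z_def .
    show "indep_var borel (X s) borel (\<lambda>\<omega>. X r \<omega> - k s * X s \<omega>)"
      using normal_indep_subalgebra_if_char(2)[OF subalg[OF sr(1)] Zm l0 char XF[OF sr(1)]] unfolding Z_def .
  qed
qed

text \<open>The transition from time 0, where the subtracted multiple of \<open>X 0\<close> vanishes
  almost surely.\<close>

lemma sde_marginal:
  assumes BM: "brownian_motion M F W"
    and \<alpha>: "\<alpha> \<in> borel_measurable (lebesgue_on {0..})"
    and sde: "sde_solution M F W \<alpha> X"
    and r: "0 < r" and B: "\<And>u. u \<in> {0..r} \<Longrightarrow> \<bar>\<alpha> u\<bar> \<le> B"
  obtains v where "exp (- (2 * B * r)) * r \<le> v"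
    "distributed M lborel (X r) (normal_density 0 (sqrt v))"
proof -
  obtain a v where v: "exp (- (2 * B * r)) * (r - 0) \<le> v"
    and dist: "distributed M lborel (\<lambda>\<omega>. X r \<omega> - a * X 0 \<omega>) (normal_density 0 (sqrt v))"
    using sde_transition[OF BM \<alpha> sde order_refl r B] .
  have X0: "AE \<omega> in M. X 0 \<omega> = 0" using sde by (simp add: sde_solution_def)
  have X: "X u \<in> borel_measurable M" if "0 \<le> u" for u
    using sde that measurable_from_subalg[OF subalg, of u "X u"]
    by (simp add: sde_solution_def adapted_def)
  have [measurable]: "X r \<in> borel_measurable M" "X 0 \<in> borel_measurable M" using X r by auto
  have "distr M lborel (X r) = distr M lborel (\<lambda>\<omega>. X r \<omega> - a * X 0 \<omega>)"
    using X0 by (intro distr_cong_AE) auto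
  then have "distributed M lborel (X r) (normal_density 0 (sqrt v))"
    using dist unfolding distributed_def by simp
  with v show ?thesis by (intro that) simp
qed

end

section \<open>Two-point expectations of heat kernels\<close>

lemma heat_kernel_eq_normal_density: "0 < e \<Longrightarrow> heat_kernel e y = normal_density 0 (sqrt e) y"
  by (simp add: heat_kernel_def normal_density_def)

lemma heat_kernel_nonneg: "0 < e \<Longrightarrow> 0 \<le> heat_kernel e y"
  by (simp add: heat_kernel_eq_normal_density)

lemma borel_measurable_heat_kernel[measurable]: "heat_kernel e \<in> borel_measurable borel"
  unfolding heat_kernel_def by measurable

lemma normal_density_le:
  assumes "0 < \<sigma>"
  shows "normal_density \<mu> \<sigma> y \<le> 1 / (sqrt (2 * pi) * \<sigma>)"
proof -
  have "normal_density \<mu> \<sigma> y \<le> 1 / sqrt (2 * pi * \<sigma>\<^sup>2) * 1"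
    unfolding normal_density_def by (intro mult_left_mono) auto
  then show ?thesis using assms by (simp add: real_sqrt_mult)
qed

lemma heat_kernel_le: "0 < e \<Longrightarrow> heat_kernel e y \<le> 1 / (sqrt (2 * pi) * sqrt e)"
  using normal_density_le[of "sqrt e" 0 y] by (simp add: heat_kernel_eq_normal_density)

lemma abs_heat_kernel_mult_le:
  assumes "0 < e" "0 < e'"
  shows "\<bar>heat_kernel e u * heat_kernel e' v\<bar> \<le> (1 / (sqrt (2 * pi) * sqrt e)) * (1 / (sqrt (2 * pi) * sqrt e'))"
proof -
  have "\<bar>heat_kernel e u * heat_kernel e' v\<bar> = heat_kernel e u * heat_kernel e' v"
    using assms by (simp add: heat_kernel_nonneg)
  also have "\<dots> \<le> (1 / (sqrt (2 * pi) * sqrt e)) * (1 / (sqrt (2 * pi) * sqrt e'))"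
    using assms by (intro mult_mono heat_kernel_le heat_kernel_nonneg) auto
  finally show ?thesis .
qed

lemma normal_density_tendsto:
  "(f \<longlongrightarrow> l) G \<Longrightarrow> ((\<lambda>n. normal_density 0 \<sigma> (f n)) \<longlongrightarrow> normal_density 0 \<sigma> l) G"
  unfolding normal_density_def divide_inverse by (intro tendsto_intros)

text \<open>The substitution \<open>y = c + sqrt e * u\<close> moves the width out of the kernel,
  where it is singular at 0, into the argument of \<open>f\<close>. The measure no longer depends on
  \<open>e\<close>, so for continuous bounded \<open>f\<close> dominated convergence
  applies.\<close>

lemma integral_heat_kernel_shift:
  fixes f :: "real \<Rightarrow> real"
  assumes e: "0 < e" and [measurable]: "f \<in> borel_measurable borel"
  shows "(\<integral>y. heat_kernel e (y - c) * f y \<partial>lborel) = (\<integral>u. f (c + sqrt e * u) \<partial>std_normal_distribution)"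
proof -
  have "(\<integral>y. heat_kernel e (y - c) * f y \<partial>lborel) =
      \<bar>sqrt e\<bar> *\<^sub>R (\<integral>u. heat_kernel e ((c + sqrt e * u) - c) * f (c + sqrt e * u) \<partial>lborel)"
    using e by (intro lborel_integral_real_affine) simp
  also have "\<dots> = (\<integral>u. sqrt e * (heat_kernel e ((c + sqrt e * u) - c) * f (c + sqrt e * u)) \<partial>lborel)"
    using e by simp
  also have "\<dots> = (\<integral>u. std_normal_density u *\<^sub>R f (c + sqrt e * u) \<partial>lborel)"
    using e by (intro Bochner_Integration.integral_cong refl)
      (simp add: heat_kernel_def std_normal_density_def power_mult_distrib real_sqrt_mult)
  also have "\<dots> = (\<integral>u. f (c + sqrt e * u) \<partial>std_normal_distribution)"
    by (rule integral_density[symmetric]) auto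
  finally show ?thesis .
qed

text \<open>By independence the pair of \<open>U\<close> and \<open>V - a U\<close> has a product
  law. Integrating over the second component with the first fixed, and then over the first, each
  integral is a heat kernel against a normal density and is rewritten by
  \<open>integral_heat_kernel_shift\<close>.\<close>

lemma (in prob_space) heat_kernel_two_point:
  fixes U V :: "'a \<Rightarrow> real"
  assumes U: "distributed M lborel U (normal_density 0 \<sigma>\<^sub>0)"
    and Z: "distributed M lborel (\<lambda>\<omega>. V \<omega> - a * U \<omega>) (normal_density 0 \<sigma>)"
    and indep: "indep_var borel U borel (\<lambda>\<omega>. V \<omega> - a * U \<omega>)"
    and \<sigma>: "0 < \<sigma>\<^sub>0" "0 < \<sigma>" and e: "0 < e" "0 < e'"
  shows "expectation (\<lambda>\<omega>. heat_kernel e (U \<omega> - x) * heat_kernel e' (V \<omega> - x)) =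
    (\<integral>u. normal_density 0 \<sigma>\<^sub>0 (x + sqrt e * u) *
      (\<integral>w. normal_density 0 \<sigma> (x - a * (x + sqrt e * u) + sqrt e' * w) \<partial>std_normal_distribution)
      \<partial>std_normal_distribution)"
proof -
  let ?Z = "\<lambda>\<omega>. V \<omega> - a * U \<omega>"
  define N0 where "N0 = density lborel (\<lambda>x. ennreal (normal_density 0 \<sigma>\<^sub>0 x))"
  define N where "N = density lborel (\<lambda>x. ennreal (normal_density 0 \<sigma> x))"
  interpret N0: prob_space N0 unfolding N0_def using \<sigma>(1) by (rule prob_space_normal_density)
  interpret N: prob_space N unfolding N_def using \<sigma>(2) by (rule prob_space_normal_density)
  interpret NN: pair_prob_space N0 N ..
  interpret S: prob_space std_normal_distribution by (rule prob_space_normal_density) simp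
  have [measurable]: "U \<in> borel_measurable M" "?Z \<in> borel_measurable M"
    using distributed_measurable[OF U] distributed_measurable[OF Z] by simp_all
  have N0: "distr M borel U = N0" "distr M borel ?Z = N"
    using distributed_distr_eq_density[OF U] distributed_distr_eq_density[OF Z]
    by (simp_all add: N0_def N_def distr_cong[OF refl sets_lborel[symmetric] refl])
  have sN[measurable_cong]: "sets N0 = sets borel" "sets N = sets borel" by (simp_all add: N0_def N_def)
  have joint: "distr M (borel \<Otimes>\<^sub>M borel) (\<lambda>\<omega>. (U \<omega>, ?Z \<omega>)) = N0 \<Otimes>\<^sub>M N"
    using indep unfolding indep_var_distribution_eq N0 by simp
  let ?f = "\<lambda>(y, z). heat_kernel e (y - x) * heat_kernel e' (a * y + z - x)"
  have "expectation (\<lambda>\<omega>. heat_kernel e (U \<omega> - x) * heat_kernel e' (V \<omega> - x)) =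
      expectation (\<lambda>\<omega>. ?f (U \<omega>, ?Z \<omega>))" by simp
  also have "\<dots> = (\<integral>p. ?f p \<partial>(N0 \<Otimes>\<^sub>M N))"
    unfolding joint[symmetric] by (rule integral_distr[symmetric]) measurable
  also have "\<dots> = (\<integral>y. (\<integral>z. ?f (y, z) \<partial>N) \<partial>N0)"
  proof (rule NN.integral_fst'[symmetric])
    show "integrable (N0 \<Otimes>\<^sub>M N) ?f"
    proof (rule NN.P.integrable_const_bound)
      show "AE p in N0 \<Otimes>\<^sub>M N. norm (?f p) \<le> (1 / (sqrt (2 * pi) * sqrt e)) * (1 / (sqrt (2 * pi) * sqrt e'))"
      proof (rule AE_I2)
        fix p :: "real \<times> real"
        obtain y z where p: "p = (y, z)" by (cases p)
        show "norm (?f p) \<le> (1 / (sqrt (2 * pi) * sqrt e)) * (1 / (sqrt (2 * pi) * sqrt e'))"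
          using abs_heat_kernel_mult_le[OF e] by (simp only: p prod.case real_norm_def)
      qed
    qed measurable
  qed
  also have "\<dots> = (\<integral>y. heat_kernel e (y - x) *
      (\<integral>w. normal_density 0 \<sigma> (x - a * y + sqrt e' * w) \<partial>std_normal_distribution) \<partial>N0)"
  proof (intro Bochner_Integration.integral_cong refl)
    fix y
    have "(\<integral>z. ?f (y, z) \<partial>N) = heat_kernel e (y - x) * (\<integral>z. heat_kernel e' (a * y + z - x) \<partial>N)"
      by simp
    also have "(\<integral>z. heat_kernel e' (a * y + z - x) \<partial>N) =
        (\<integral>z. normal_density 0 \<sigma> z *\<^sub>R heat_kernel e' (a * y + z - x) \<partial>lborel)"
      unfolding N_def by (rule integral_density) auto
    \<comment> \<open>Read as a function of \<open>z\<close>, the second kernel is centred at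
      \<open>x - a * y\<close>.\<close>
    also have "\<dots> = (\<integral>z. heat_kernel e' (z - (x - a * y)) * normal_density 0 \<sigma> z \<partial>lborel)"
      by (simp add: algebra_simps)
    also have "\<dots> = (\<integral>w. normal_density 0 \<sigma> (x - a * y + sqrt e' * w) \<partial>std_normal_distribution)"
      by (rule integral_heat_kernel_shift[OF e(2)]) measurable
    finally show "(\<integral>z. ?f (y, z) \<partial>N) = heat_kernel e (y - x) *
      (\<integral>w. normal_density 0 \<sigma> (x - a * y + sqrt e' * w) \<partial>std_normal_distribution)" .
  qed
  also have "\<dots> = (\<integral>y. normal_density 0 \<sigma>\<^sub>0 y *\<^sub>R (heat_kernel e (y - x) *
      (\<integral>w. normal_density 0 \<sigma> (x - a * y + sqrt e' * w) \<partial>std_normal_distribution)) \<partial>lborel)"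
    unfolding N0_def by (rule integral_density) auto
  also have "\<dots> = (\<integral>y. heat_kernel e (y - x) * (normal_density 0 \<sigma>\<^sub>0 y *
      (\<integral>w. normal_density 0 \<sigma> (x - a * y + sqrt e' * w) \<partial>std_normal_distribution)) \<partial>lborel)"
    by (simp add: mult_ac)
  also have "\<dots> = (\<integral>u. normal_density 0 \<sigma>\<^sub>0 (x + sqrt e * u) *
      (\<integral>w. normal_density 0 \<sigma> (x - a * (x + sqrt e * u) + sqrt e' * w) \<partial>std_normal_distribution)
      \<partial>std_normal_distribution)"
    by (rule integral_heat_kernel_shift[OF e(1)]) measurable
  finally show ?thesis .
qed

text \<open>Both claims rest on normal densities being bounded by their peak value, which is
  integrated against probability measures. The limit is the joint density of \<open>U\<close> and
  \<open>V\<close> at (x, x); it is the same however the two widths tend to 0, and this is what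
  later makes the four terms cancel.\<close>

lemma (in prob_space)
  fixes U V :: "'a \<Rightarrow> real"
  assumes U: "distributed M lborel U (normal_density 0 \<sigma>\<^sub>0)"
    and Z: "distributed M lborel (\<lambda>\<omega>. V \<omega> - a * U \<omega>) (normal_density 0 \<sigma>)"
    and indep: "indep_var borel U borel (\<lambda>\<omega>. V \<omega> - a * U \<omega>)"
    and \<sigma>: "0 < \<sigma>\<^sub>0" "0 < \<sigma>"
  shows heat_kernel_two_point_le: "0 < e \<Longrightarrow> 0 < e' \<Longrightarrow>
      expectation (\<lambda>\<omega>. heat_kernel e (U \<omega> - x) * heat_kernel e' (V \<omega> - x)) \<le> 1 / (2 * pi * (\<sigma>\<^sub>0 * \<sigma>))"
    and heat_kernel_two_point_tendsto: "(\<And>n. 0 < f n) \<Longrightarrow> (\<And>n. 0 < g n) \<Longrightarrow> f \<longlonglongrightarrow> 0 \<Longrightarrow> g \<longlonglongrightarrow> 0 \<Longrightarrow>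
      (\<lambda>n. expectation (\<lambda>\<omega>. heat_kernel (f n) (U \<omega> - x) * heat_kernel (g n) (V \<omega> - x)))
        \<longlonglongrightarrow> normal_density 0 \<sigma>\<^sub>0 x * normal_density 0 \<sigma> (x - a * x)"
proof -
  interpret S: prob_space std_normal_distribution by (rule prob_space_normal_density) simp
  define H where "H e e' u = (\<integral>w. normal_density 0 \<sigma> (x - a * (x + sqrt e * u) + sqrt e' * w) \<partial>std_normal_distribution)"
    for e e' u
  have [measurable]: "H e e' \<in> borel_measurable borel" for e e' unfolding H_def by measurable
  let ?b = "\<lambda>\<sigma>. 1 / (sqrt (2 * pi) * \<sigma>)"
  have two: "expectation (\<lambda>\<omega>. heat_kernel e (U \<omega> - x) * heat_kernel e' (V \<omega> - x)) =
      (\<integral>u. normal_density 0 \<sigma>\<^sub>0 (x + sqrt e * u) * H e e' u \<partial>std_normal_distribution)"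
    if "0 < e" "0 < e'" for e e'
    unfolding H_def by (rule heat_kernel_two_point[OF U Z indep \<sigma> that])
  have H0: "0 \<le> H e e' u" for e e' u unfolding H_def by simp
  have Hb: "H e e' u \<le> ?b \<sigma>" for e e' u
    unfolding H_def
  proof (rule S.integral_le_const)
    show "integrable std_normal_distribution (\<lambda>w. normal_density 0 \<sigma> (x - a * (x + sqrt e * u) + sqrt e' * w))"
      by (rule S.integrable_const_bound[of _ "?b \<sigma>"]) (auto intro!: AE_I2 normal_density_le \<sigma>)
  qed (auto intro!: AE_I2 normal_density_le \<sigma>)
  have pb: "normal_density 0 \<sigma>\<^sub>0 y * H e e' u \<le> ?b \<sigma>\<^sub>0 * ?b \<sigma>" for y e e' u
    using \<sigma> by (intro mult_mono normal_density_le Hb H0) auto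
  have pn: "norm (normal_density 0 \<sigma>\<^sub>0 y * H e e' u) \<le> ?b \<sigma>\<^sub>0 * ?b \<sigma>" for y e e' u
    using pb[of y e e' u] H0[of e e' u] by (simp add: abs_mult)
  show "expectation (\<lambda>\<omega>. heat_kernel e (U \<omega> - x) * heat_kernel e' (V \<omega> - x)) \<le> 1 / (2 * pi * (\<sigma>\<^sub>0 * \<sigma>))"
    if "0 < e" "0 < e'" for e e'
  proof -
    have "(\<integral>u. normal_density 0 \<sigma>\<^sub>0 (x + sqrt e * u) * H e e' u \<partial>std_normal_distribution) \<le> ?b \<sigma>\<^sub>0 * ?b \<sigma>"
    proof (rule S.integral_le_const)
      show "integrable std_normal_distribution (\<lambda>u. normal_density 0 \<sigma>\<^sub>0 (x + sqrt e * u) * H e e' u)"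
        by (rule S.integrable_const_bound[OF AE_I2[OF pn]]) measurable
    qed (rule AE_I2[OF pb])
    also have "?b \<sigma>\<^sub>0 * ?b \<sigma> = 1 / (2 * pi * (\<sigma>\<^sub>0 * \<sigma>))"
    proof -
      have "sqrt (2 * pi) * sqrt (2 * pi) = 2 * pi" by simp
      then show ?thesis by (simp add: field_simps)
    qed
    finally show ?thesis using two[OF that] by simp
  qed
  show "(\<lambda>n. expectation (\<lambda>\<omega>. heat_kernel (f n) (U \<omega> - x) * heat_kernel (g n) (V \<omega> - x)))
        \<longlonglongrightarrow> normal_density 0 \<sigma>\<^sub>0 x * normal_density 0 \<sigma> (x - a * x)"
    if fg: "\<And>n. 0 < f n" "\<And>n. 0 < g n" "f \<longlonglongrightarrow> 0" "g \<longlonglongrightarrow> 0" for f g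
  proof -
    have sq: "(\<lambda>n. sqrt (f n)) \<longlonglongrightarrow> 0" "(\<lambda>n. sqrt (g n)) \<longlonglongrightarrow> 0"
      using tendsto_real_sqrt[OF fg(3)] tendsto_real_sqrt[OF fg(4)] by simp_all
    have arg: "(\<lambda>n. x + sqrt (f n) * u) \<longlonglongrightarrow> x" for u
      using tendsto_add[OF tendsto_const tendsto_mult_left_zero[OF sq(1)], of x u] by simp
    \<comment> \<open>Dominated convergence is applied twice: here to the inner integral at fixed
      \<open>u\<close>, below to the outer one.\<close>
    have Hlim: "(\<lambda>n. H (f n) (g n) u) \<longlonglongrightarrow> normal_density 0 \<sigma> (x - a * x)" for u
    proof -
      have "(\<lambda>n. H (f n) (g n) u) \<longlonglongrightarrow> (\<integral>w. normal_density 0 \<sigma> (x - a * x) \<partial>std_normal_distribution)"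
        unfolding H_def
      proof (rule integral_dominated_convergence[where w="\<lambda>_. ?b \<sigma>"])
        show "AE w in std_normal_distribution.
            (\<lambda>n. normal_density 0 \<sigma> (x - a * (x + sqrt (f n) * u) + sqrt (g n) * w))
              \<longlonglongrightarrow> normal_density 0 \<sigma> (x - a * x)"
        proof (intro AE_I2 normal_density_tendsto)
          fix w
          show "(\<lambda>n. x - a * (x + sqrt (f n) * u) + sqrt (g n) * w) \<longlonglongrightarrow> x - a * x"
            using tendsto_add[OF tendsto_diff[OF tendsto_const tendsto_mult[OF tendsto_const arg]]
                tendsto_mult_left_zero[OF sq(2)], of x a u w] by simp
        qed
        show "AE w in std_normal_distribution.
            norm (normal_density 0 \<sigma> (x - a * (x + sqrt (f n) * u) + sqrt (g n) * w)) \<le> ?b \<sigma>" for n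
          using normal_density_le[OF \<sigma>(2)] by simp
      qed auto
      then show ?thesis using S.prob_space by simp
    qed
    have "(\<lambda>n. \<integral>u. normal_density 0 \<sigma>\<^sub>0 (x + sqrt (f n) * u) * H (f n) (g n) u \<partial>std_normal_distribution)
        \<longlonglongrightarrow> (\<integral>u. normal_density 0 \<sigma>\<^sub>0 x * normal_density 0 \<sigma> (x - a * x) \<partial>std_normal_distribution)"
    proof (rule integral_dominated_convergence[where w="\<lambda>_. ?b \<sigma>\<^sub>0 * ?b \<sigma>"])
      show "AE u in std_normal_distribution. (\<lambda>n. normal_density 0 \<sigma>\<^sub>0 (x + sqrt (f n) * u) * H (f n) (g n) u)
          \<longlonglongrightarrow> normal_density 0 \<sigma>\<^sub>0 x * normal_density 0 \<sigma> (x - a * x)"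
        by (intro AE_I2 tendsto_mult normal_density_tendsto arg Hlim)
      show "AE u in std_normal_distribution.
          norm (normal_density 0 \<sigma>\<^sub>0 (x + sqrt (f n) * u) * H (f n) (g n) u) \<le> ?b \<sigma>\<^sub>0 * ?b \<sigma>" for n
        by (rule AE_I2[OF pn])
    qed (simp_all, measurable)
    then show ?thesis using S.prob_space by (simp add: two fg)
  qed
qed

section \<open>Integrability of the singular dominating kernel\<close>

text \<open>The inverse square root is cut off at \<open>\<bar>t\<bar>\<close> and extended evenly.
  Defined on the whole line it can be translated, and evenness makes its value at
  \<open>r - s\<close> indifferent to the order of the two times.\<close>

lemma integrable_inverse_sqrt:
  obtains \<psi> :: "real \<Rightarrow> real" where "integrable lborel \<psi>" "\<And>u. 0 \<le> \<psi> u" "\<And>u. \<psi> (- u) = \<psi> u"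
    "\<And>u. 0 < u \<Longrightarrow> u \<le> t \<Longrightarrow> \<psi> u = 1 / sqrt u"
proof -
  define \<psi>\<^sub>0 where "\<psi>\<^sub>0 u = indicator {0..\<bar>t\<bar>} u *\<^sub>R (u powr (-1/2))" for u :: real
  have "(\<lambda>u. u powr (-1/2)) integrable_on {0..\<bar>t\<bar>}"
    using has_integral_powr_from_0[of "-1/2" "\<bar>t\<bar>"] by auto
  then have "set_integrable lebesgue {0..\<bar>t\<bar>} (\<lambda>u. u powr (-1/2))"
    by (intro nonnegative_absolutely_integrable_1) auto
  then have int0: "integrable lborel \<psi>\<^sub>0"
    unfolding set_integrable_def \<psi>\<^sub>0_def by (subst (asm) integrable_completion) auto
  have int1: "integrable lborel (\<lambda>u. \<psi>\<^sub>0 (- u))"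
    using lborel_integrable_real_affine[OF int0, of "-1" 0] by simp
  show thesis
  proof (rule that[of "\<lambda>u. \<psi>\<^sub>0 u + \<psi>\<^sub>0 (- u)"])
    show "integrable lborel (\<lambda>u. \<psi>\<^sub>0 u + \<psi>\<^sub>0 (- u))" using int0 int1 by auto
    show "0 \<le> \<psi>\<^sub>0 u + \<psi>\<^sub>0 (- u)" for u by (simp add: \<psi>\<^sub>0_def)
    show "\<psi>\<^sub>0 u + \<psi>\<^sub>0 (- u) = 1 / sqrt u" if "0 < u" "u \<le> t" for u
      using that by (simp add: \<psi>\<^sub>0_def powr_minus powr_half_sqrt inverse_eq_divide)
  qed simp
qed

text \<open>Integrating over \<open>s\<close> first, translation and reflection invariance bound the
  inner integral by the total mass \<open>K\<close> of \<open>\<psi>\<close> uniformly in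
  \<open>r\<close>, so the double integral is at most \<open>K * K\<close>. The second kernel is the
  first with its variables exchanged, by evenness of \<open>\<psi>\<close>.\<close>

lemma
  fixes \<psi> :: "real \<Rightarrow> real" and A :: "real set"
  assumes \<psi>: "integrable lborel \<psi>" "\<And>u. 0 \<le> \<psi> u" "\<And>u. \<psi> (- u) = \<psi> u" and A[measurable]: "A \<in> sets borel"
  defines "R \<equiv> restrict_space lborel A"
  shows integrable_convolution_kernel_fst: "integrable (R \<Otimes>\<^sub>M R) (\<lambda>(r, s). \<psi> r * \<psi> (r - s))"
    and integrable_convolution_kernel_snd: "integrable (R \<Otimes>\<^sub>M R) (\<lambda>(r, s). \<psi> s * \<psi> (r - s))"
proof -
  interpret R: sigma_finite_measure R
    unfolding R_def by (rule sigma_finite_measure_restrict_space) (auto intro: sigma_finite_lborel)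
  interpret RR: pair_sigma_finite R R ..
  have [measurable]: "\<psi> \<in> borel_measurable borel" using \<psi>(1) by auto
  have idR[measurable]: "(\<lambda>x. x) \<in> R \<rightarrow>\<^sub>M borel"
    unfolding R_def by (rule measurable_restrict_space1) simp
  have fR[measurable]: "(\<lambda>p. fst p) \<in> R \<Otimes>\<^sub>M R \<rightarrow>\<^sub>M borel" "(\<lambda>p. snd p) \<in> R \<Otimes>\<^sub>M R \<rightarrow>\<^sub>M borel"
    using measurable_compose[OF measurable_fst idR] measurable_compose[OF measurable_snd idR] by auto
  define K where "K = (\<integral>\<^sup>+u. ennreal (\<psi> u) \<partial>lborel)"
  have K: "K < \<infinity>" unfolding K_def using \<psi>(1,2) by (simp add: nn_integral_eq_integral)
  have le: "(\<integral>\<^sup>+x. f x \<partial>R) \<le> (\<integral>\<^sup>+x. f x \<partial>lborel)" for f :: "real \<Rightarrow> ennreal"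
    unfolding R_def
    by (subst nn_integral_restrict_space) (auto intro!: nn_integral_mono split: split_indicator)
  have shift: "(\<integral>\<^sup>+s. ennreal (\<psi> (r - s)) \<partial>R) \<le> K" for r
  proof -
    have "K = (\<integral>\<^sup>+s. ennreal (\<psi> (r - s)) \<partial>lborel)"
      unfolding K_def using nn_integral_real_affine[of "\<lambda>u. ennreal (\<psi> u)" "-1" r] by simp
    then show ?thesis using le[of "\<lambda>s. ennreal (\<psi> (r - s))"] by simp
  qed
  have bound: "(\<integral>\<^sup>+r. \<integral>\<^sup>+s. ennreal (\<psi> r * \<psi> (r - s)) \<partial>R \<partial>R) < \<infinity>"
  proof -
    have "(\<integral>\<^sup>+r. \<integral>\<^sup>+s. ennreal (\<psi> r * \<psi> (r - s)) \<partial>R \<partial>R) =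
        (\<integral>\<^sup>+r. ennreal (\<psi> r) * (\<integral>\<^sup>+s. ennreal (\<psi> (r - s)) \<partial>R) \<partial>R)"
      using \<psi>(2) by (intro nn_integral_cong) (simp add: ennreal_mult nn_integral_cmult)
    also have "\<dots> \<le> (\<integral>\<^sup>+r. ennreal (\<psi> r) * K \<partial>R)"
      by (intro nn_integral_mono mult_left_mono shift) auto
    also have "\<dots> = (\<integral>\<^sup>+r. ennreal (\<psi> r) \<partial>R) * K"
      by (intro nn_integral_multc) measurable
    also have "\<dots> \<le> K * K"
      using le[of "\<lambda>r. ennreal (\<psi> r)"] by (intro mult_right_mono) (auto simp: K_def)
    also have "\<dots> < \<infinity>" using K by (simp add: ennreal_mult_less_top)
    finally show ?thesis .
  qed
  show "integrable (R \<Otimes>\<^sub>M R) (\<lambda>(r, s). \<psi> r * \<psi> (r - s))"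
  proof (rule integrableI_nonneg)
    show m: "(\<lambda>(r, s). \<psi> r * \<psi> (r - s)) \<in> borel_measurable (R \<Otimes>\<^sub>M R)"
      unfolding split_beta by measurable
    show "(\<integral>\<^sup>+p. ennreal (case p of (r, s) \<Rightarrow> \<psi> r * \<psi> (r - s)) \<partial>(R \<Otimes>\<^sub>M R)) < \<infinity>"
      using bound R.nn_integral_fst[of "\<lambda>p. ennreal (case p of (r, s) \<Rightarrow> \<psi> r * \<psi> (r - s))" R] m by simp
  qed (use \<psi>(2) in auto)
  then have "integrable (R \<Otimes>\<^sub>M R) (\<lambda>(s, r). (\<lambda>(r, s). \<psi> r * \<psi> (r - s)) (r, s))"
    by (rule RR.integrable_product_swap)
  moreover have "\<psi> (r - s) = \<psi> (s - r)" for r s using \<psi>(3)[of "s - r"] by simp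
  ultimately show "integrable (R \<Otimes>\<^sub>M R) (\<lambda>(r, s). \<psi> s * \<psi> (r - s))"
    by (simp add: case_prod_beta')
qed

section \<open>Joint measurability and second moments of occupation integrals\<close>

text \<open>Sampling the process at the largest multiple of \<open>1 / Suc n\<close> not exceeding
  the time gives a countable patchwork of measurable pieces, and continuity of the paths lets it
  converge pointwise.\<close>

lemma borel_measurable_continuous_process:
  fixes Y :: "real \<Rightarrow> 'a \<Rightarrow> real"
  assumes meas: "\<And>t. Y t \<in> borel_measurable M"
    and cont: "\<And>\<omega>. \<omega> \<in> space M \<Longrightarrow> continuous_on UNIV (\<lambda>t. Y t \<omega>)"
  shows "(\<lambda>p. Y (fst p) (snd p)) \<in> borel_measurable (borel \<Otimes>\<^sub>M M)"
proof (rule borel_measurable_LIMSEQ_real)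
  fix n :: nat
  have "(\<lambda>p. Y (real_of_int i / real (Suc n)) (snd p)) \<in> borel_measurable (borel \<Otimes>\<^sub>M M)" for i :: int
    using measurable_compose[OF measurable_snd meas] .
  then show "(\<lambda>p. Y (real_of_int \<lfloor>real (Suc n) * fst p\<rfloor> / real (Suc n)) (snd p)) \<in> borel_measurable (borel \<Otimes>\<^sub>M M)"
    by (rule measurable_compose_countable) measurable
next
  fix p :: "real \<times> 'a" assume "p \<in> space (borel \<Otimes>\<^sub>M M)"
  then have \<omega>: "snd p \<in> space M" by (auto simp: space_pair_measure)
  have "(\<lambda>n. real_of_int \<lfloor>real (Suc n) * fst p\<rfloor> / real (Suc n)) \<longlonglongrightarrow> fst p"
  proof (rule LIMSEQ_I)
    fix e :: real assume "0 < e"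
    have "\<forall>\<^sub>F n in sequentially. 1 / real (Suc n) < e"
      using \<open>0 < e\<close> order_tendstoD(2)[OF LIMSEQ_inverse_real_of_nat, of e] by (simp add: inverse_eq_divide)
    then have "\<forall>\<^sub>F n in sequentially. norm (real_of_int \<lfloor>real (Suc n) * fst p\<rfloor> / real (Suc n) - fst p) < e"
    proof eventually_elim
      case (elim n)
      define N where "N = real (Suc n)"
      have N: "0 < N" by (simp add: N_def)
      have "\<bar>real_of_int \<lfloor>N * fst p\<rfloor> - N * fst p\<bar> \<le> 1" by linarith
      then have "\<bar>real_of_int \<lfloor>N * fst p\<rfloor> - N * fst p\<bar> / N \<le> 1 / N"
        using N by (intro divide_right_mono) auto
      moreover have "real_of_int \<lfloor>N * fst p\<rfloor> / N - fst p = (real_of_int \<lfloor>N * fst p\<rfloor> - N * fst p) / N"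
        using N by (simp add: diff_divide_distrib)
      ultimately show ?case using elim N unfolding N_def[symmetric] by simp
    qed
    then show "\<exists>no. \<forall>n\<ge>no. norm (real_of_int \<lfloor>real (Suc n) * fst p\<rfloor> / real (Suc n) - fst p) < e"
      by (simp add: eventually_sequentially)
  qed
  moreover have "isCont (\<lambda>t. Y t (snd p)) (fst p)"
    using cont[OF \<omega>] by (simp add: continuous_on_eq_continuous_at)
  ultimately show "(\<lambda>n. Y (real_of_int \<lfloor>real (Suc n) * fst p\<rfloor> / real (Suc n)) (snd p)) \<longlonglongrightarrow> Y (fst p) (snd p)"
    by (rule isCont_tendsto_compose[rotated])
qed

text \<open>Serves to transfer measurability from a jointly measurable modification to quantities
  built from the given process, which agree with it only almost surely.\<close>

lemma (in complete_measure) borel_measurable_AE_eq: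
  fixes f g :: "'a \<Rightarrow> 'b::topological_space"
  assumes f: "f \<in> borel_measurable M" and eq: "AE x in M. f x = g x"
  shows "g \<in> borel_measurable M"
proof (rule measurableI)
  fix A :: "'b set" assume A: "A \<in> sets borel"
  show "g -` A \<inter> space M \<in> sets M"
  proof (rule in_sets_AE[OF _ measurable_sets[OF f A]])
    show "AE x in M. x \<in> f -` A \<inter> space M \<longleftrightarrow> x \<in> g -` A \<inter> space M"
      using eq by eventually_elim auto
  qed simp
qed simp

text \<open>The square of a time integral is a double time integral, and Fubini exchanges it with
  the expectation. All integrability comes from bounded integrands on finite measures, since the
  bound \<open>K\<close> may depend on the kernel widths.\<close>

lemma (in prob_space) second_moment_occupation_integral:
  fixes Y :: "real \<Rightarrow> 'a \<Rightarrow> real" and q :: "real \<Rightarrow> real"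
  assumes R: "finite_measure R" and sR: "sets R = sets (restrict_space borel A)"
    and Y: "(\<lambda>p. Y (fst p) (snd p)) \<in> borel_measurable (borel \<Otimes>\<^sub>M M)"
    and q[measurable]: "q \<in> borel_measurable borel" and K: "\<And>y. \<bar>q y\<bar> \<le> K"
  shows "expectation (\<lambda>\<omega>. (\<integral>r. q (Y r \<omega>) \<partial>R)\<^sup>2) =
      (\<integral>p. expectation (\<lambda>\<omega>. q (Y (fst p) \<omega>) * q (Y (snd p) \<omega>)) \<partial>(R \<Otimes>\<^sub>M R))" (is ?eq)
    and "(\<lambda>p. expectation (\<lambda>\<omega>. q (Y (fst p) \<omega>) * q (Y (snd p) \<omega>))) \<in> borel_measurable (R \<Otimes>\<^sub>M R)" (is ?meas)
    and "(\<lambda>\<omega>. \<integral>r. q (Y r \<omega>) \<partial>R) \<in> borel_measurable M" (is ?measL)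
    and "\<omega> \<in> space M \<Longrightarrow> integrable R (\<lambda>r. q (Y r \<omega>))"
proof -
  interpret R: finite_measure R by (rule R)
  interpret RR: pair_sigma_finite R R ..
  interpret P: finite_measure "R \<Otimes>\<^sub>M R" by (rule finite_measure_pair_measure[OF R R])
  interpret PM: pair_sigma_finite "R \<Otimes>\<^sub>M R" M ..
  interpret PMf: finite_measure "(R \<Otimes>\<^sub>M R) \<Otimes>\<^sub>M M"
    by (rule finite_measure_pair_measure) unfold_locales
  have idR: "(\<lambda>x. x) \<in> R \<rightarrow>\<^sub>M borel"
    using measurable_restrict_space1[of "\<lambda>x::real. x" borel borel A] sR
    by (simp cong: measurable_cong_sets)
  have comp[measurable]: "(\<lambda>x. Y (f x) (g x)) \<in> borel_measurable N"
    if [measurable]: "f \<in> N \<rightarrow>\<^sub>M R" "g \<in> N \<rightarrow>\<^sub>M M" for f g and N :: "'c measure"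
  proof -
    have "(\<lambda>x. (f x, g x)) \<in> N \<rightarrow>\<^sub>M borel \<Otimes>\<^sub>M M"
      using measurable_compose[OF that(1) idR] by measurable
    from measurable_compose[OF this Y] show ?thesis by simp
  qed
  have K0: "0 \<le> K" using K[of 0] by linarith
  have qq: "\<bar>q y * q z\<bar> \<le> K * K" for y z
    unfolding abs_mult using K K0 by (intro mult_mono) auto
  show intR: "integrable R (\<lambda>r. q (Y r \<omega>))" if "\<omega> \<in> space M" for \<omega>
  proof (rule R.integrable_const_bound)
    show "(\<lambda>r. q (Y r \<omega>)) \<in> borel_measurable R"
      using that by measurable
  qed (use K in auto)
  show ?measL by measurable
  show ?meas by measurable
  have sq: "(\<integral>r. q (Y r \<omega>) \<partial>R)\<^sup>2 = (\<integral>p. q (Y (fst p) \<omega>) * q (Y (snd p) \<omega>) \<partial>(R \<Otimes>\<^sub>M R))"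
    if \<omega>: "\<omega> \<in> space M" for \<omega>
  proof -
    have "integrable (R \<Otimes>\<^sub>M R) (\<lambda>p. q (Y (fst p) \<omega>) * q (Y (snd p) \<omega>))"
    proof (rule P.integrable_const_bound)
      show "(\<lambda>p. q (Y (fst p) \<omega>) * q (Y (snd p) \<omega>)) \<in> borel_measurable (R \<Otimes>\<^sub>M R)"
        using \<omega> by measurable
    qed (use qq in auto)
    from RR.integral_fst'[OF this] show ?thesis
      by (simp add: power2_eq_square)
  qed
  have "integrable ((R \<Otimes>\<^sub>M R) \<Otimes>\<^sub>M M) (\<lambda>(p, \<omega>). q (Y (fst p) \<omega>) * q (Y (snd p) \<omega>))"
  proof (rule PMf.integrable_const_bound[of _ "K * K"])
    show "(\<lambda>(p, \<omega>). q (Y (fst p) \<omega>) * q (Y (snd p) \<omega>)) \<in> borel_measurable ((R \<Otimes>\<^sub>M R) \<Otimes>\<^sub>M M)"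
      by measurable
  qed (use qq in \<open>simp add: split_beta\<close>)
  from PM.Fubini_integral[OF this] show ?eq
    using sq by (simp cong: Bochner_Integration.integral_cong)
qed

section \<open>The Cauchy estimate and existence of the local time\<close>

text \<open>Its occupation integral is the difference of two approximations, so the Cauchy criterion
  becomes a statement about a single second moment.\<close>

definition heat_diff :: "real \<Rightarrow> real \<Rightarrow> real \<Rightarrow> real \<Rightarrow> real" where
  "heat_diff x e e' y = heat_kernel e (y - x) - heat_kernel e' (y - x)"

lemma borel_measurable_heat_diff[measurable]: "heat_diff x e e' \<in> borel_measurable borel"
  unfolding heat_diff_def by measurable

lemma abs_heat_diff_le:
  assumes "0 < e" "0 < e'"
  shows "\<bar>heat_diff x e e' y\<bar> \<le> 1 / (sqrt (2 * pi) * sqrt e) + 1 / (sqrt (2 * pi) * sqrt e')"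
  using heat_kernel_le[OF assms(1), of "y - x"] heat_kernel_le[OF assms(2), of "y - x"]
    heat_kernel_nonneg[OF assms(1), of "y - x"] heat_kernel_nonneg[OF assms(2), of "y - x"]
  unfolding heat_diff_def by linarith

text \<open>The grouping displays the cancellation: if all four values of \<open>J\<close> have a
  common limit, both brackets tend to 0.\<close>

lemma (in prob_space) expectation_heat_diff_mult:
  fixes U V :: "'a \<Rightarrow> real" and x :: real
  assumes [measurable]: "U \<in> borel_measurable M" "V \<in> borel_measurable M" and e: "0 < e" "0 < e'"
  defines "J \<equiv> \<lambda>a b. expectation (\<lambda>\<omega>. heat_kernel a (U \<omega> - x) * heat_kernel b (V \<omega> - x))"
  shows "expectation (\<lambda>\<omega>. heat_diff x e e' (U \<omega>) * heat_diff x e e' (V \<omega>)) =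
    (J e e - J e e') - (J e' e - J e' e')"
proof -
  have int: "integrable M (\<lambda>\<omega>. heat_kernel a (U \<omega> - x) * heat_kernel b (V \<omega> - x))" if "0 < a" "0 < b" for a b
  proof (rule integrable_const_bound[of _ "(1 / (sqrt (2 * pi) * sqrt a)) * (1 / (sqrt (2 * pi) * sqrt b))"])
    show "AE \<omega> in M. norm (heat_kernel a (U \<omega> - x) * heat_kernel b (V \<omega> - x))
        \<le> (1 / (sqrt (2 * pi) * sqrt a)) * (1 / (sqrt (2 * pi) * sqrt b))"
      unfolding real_norm_def by (intro AE_I2 abs_heat_kernel_mult_le that)
  qed measurable
  have "expectation (\<lambda>\<omega>. heat_diff x e e' (U \<omega>) * heat_diff x e e' (V \<omega>)) =
      expectation (\<lambda>\<omega>. (heat_kernel e (U \<omega> - x) * heat_kernel e (V \<omega> - x) - heat_kernel e (U \<omega> - x) * heat_kernel e' (V \<omega> - x)) -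
        (heat_kernel e' (U \<omega> - x) * heat_kernel e (V \<omega> - x) - heat_kernel e' (U \<omega> - x) * heat_kernel e' (V \<omega> - x)))"
    by (intro Bochner_Integration.integral_cong refl) (simp add: heat_diff_def algebra_simps)
  also have "\<dots> = (J e e - J e e') - (J e' e - J e' e')"
    unfolding J_def using int e by simp
  finally show ?thesis .
qed

context complete_filtered_prob_space
begin

text \<open>The normal laws of \<open>X s\<close> and of the increment have variances at least
  \<open>\<kappa> * s\<close> and \<open>\<kappa> * (r - s)\<close> with the same
  \<open>\<kappa>\<close> for all times up to \<open>t\<close>; the constant
  \<open>exp (2 * B * t)\<close> is its inverse. Convergence to 0 holds because all four two-point
  expectations share one limit.\<close>

lemma heat_diff_two_point:
  assumes BM: "brownian_motion M F W"
    and \<alpha>: "\<alpha> \<in> borel_measurable (lebesgue_on {0..})"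
    and sde: "sde_solution M F W \<alpha> X"
    and B: "\<And>u. u \<in> {0..t} \<Longrightarrow> \<bar>\<alpha> u\<bar> \<le> B"
    and sr: "0 < s" "s < r" "r \<le> t"
  shows "0 < e \<Longrightarrow> 0 < e' \<Longrightarrow>
      \<bar>expectation (\<lambda>\<omega>. heat_diff x e e' (X s \<omega>) * heat_diff x e e' (X r \<omega>))\<bar>
        \<le> exp (2 * B * t) * (1 / sqrt s * (1 / sqrt (r - s)))" (is "PROP ?bound")
    and "(\<And>n. 0 < f n) \<Longrightarrow> (\<And>n. 0 < g n) \<Longrightarrow> f \<longlonglongrightarrow> 0 \<Longrightarrow> g \<longlonglongrightarrow> 0 \<Longrightarrow>
      (\<lambda>n. expectation (\<lambda>\<omega>. heat_diff x (f n) (g n) (X s \<omega>) * heat_diff x (f n) (g n) (X r \<omega>))) \<longlonglongrightarrow> 0"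
proof -
  have B0: "0 \<le> B" using B[of t] sr by force
  have X: "X u \<in> borel_measurable M" if "0 \<le> u" for u
    using sde that measurable_from_subalg[OF subalg, of u "X u"]
    by (simp add: sde_solution_def adapted_def)
  have [measurable]: "X s \<in> borel_measurable M" "X r \<in> borel_measurable M" using X sr by auto
  obtain v\<^sub>0 where v0: "exp (- (2 * B * s)) * s \<le> v\<^sub>0"
    and U: "distributed M lborel (X s) (normal_density 0 (sqrt v\<^sub>0))"
    by (rule sde_marginal[OF BM \<alpha> sde sr(1), of B]) (use B sr in auto)
  have s0: "0 \<le> s" using sr by simp
  obtain a v where v: "exp (- (2 * B * r)) * (r - s) \<le> v"
    and V: "distributed M lborel (\<lambda>\<omega>. X r \<omega> - a * X s \<omega>) (normal_density 0 (sqrt v))"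
    and indep: "indep_var borel (X s) borel (\<lambda>\<omega>. X r \<omega> - a * X s \<omega>)"
    by (rule sde_transition[OF BM \<alpha> sde s0 sr(2), of B]) (use B sr in auto)
  define \<kappa> where "\<kappa> = exp (- (2 * B * t))"
  have \<kappa>0: "0 < \<kappa>" by (simp add: \<kappa>_def)
  have v0\<kappa>: "\<kappa> * s \<le> v\<^sub>0"
  proof -
    have "\<kappa> * s \<le> exp (- (2 * B * s)) * s"
      using sr B0 by (auto simp: \<kappa>_def intro!: mult_mono mult_left_mono)
    then show ?thesis using v0 by linarith
  qed
  have v\<kappa>: "\<kappa> * (r - s) \<le> v"
  proof -
    have "\<kappa> * (r - s) \<le> exp (- (2 * B * r)) * (r - s)"
      using sr B0 by (auto simp: \<kappa>_def intro!: mult_mono mult_left_mono)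
    then show ?thesis using v by linarith
  qed
  have pos: "0 < \<kappa> * s" "0 < \<kappa> * (r - s)" using \<kappa>0 sr by simp_all
  have \<sigma>: "0 < sqrt v\<^sub>0" "0 < sqrt v" using pos v0\<kappa> v\<kappa> by auto
  define J where "J a b = expectation (\<lambda>\<omega>. heat_kernel a (X s \<omega> - x) * heat_kernel b (X r \<omega> - x))" for a b
  have Jle: "J a b \<le> 1 / (2 * pi * (sqrt v\<^sub>0 * sqrt v))" if "0 < a" "0 < b" for a b
    unfolding J_def by (rule heat_kernel_two_point_le[OF U V indep \<sigma> that])
  have J0: "0 \<le> J a b" if "0 < a" "0 < b" for a b
    unfolding J_def using that by (intro Bochner_Integration.integral_nonneg) (simp add: heat_kernel_nonneg)
  have DJ: "expectation (\<lambda>\<omega>. heat_diff x e e' (X s \<omega>) * heat_diff x e e' (X r \<omega>)) =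
      (J e e - J e e') - (J e' e - J e' e')" if "0 < e" "0 < e'" for e e'
    unfolding J_def by (rule expectation_heat_diff_mult) (use that in simp_all)
  show "PROP ?bound"
  proof -
    assume e: "0 < e" "0 < e'"
    define b where "b = 1 / (sqrt v\<^sub>0 * sqrt v)"
    have b0: "0 \<le> b" using \<sigma> by (simp add: b_def)
    \<comment> \<open>With this every \<open>J\<close> lies between 0 and \<open>b / 2\<close>. As
      two enter positively and two negatively, the combination is at most \<open>b\<close> in
      modulus.\<close>
    have pib: "1 / (2 * pi * (sqrt v\<^sub>0 * sqrt v)) \<le> b / 2"
    proof -
      have "b * (1 / pi) \<le> b * 1" using b0 pi_gt3 by (intro mult_left_mono) auto
      moreover have "1 / (2 * pi * (sqrt v\<^sub>0 * sqrt v)) = b * (1 / pi) / 2" by (simp add: b_def)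
      ultimately show ?thesis by simp
    qed
    have "\<bar>(J e e - J e e') - (J e' e - J e' e')\<bar> \<le> b"
      using Jle[OF e(1) e(1)] Jle[OF e] Jle[OF e(2) e(1)] Jle[OF e(2) e(2)]
        J0[OF e(1) e(1)] J0[OF e] J0[OF e(2) e(1)] J0[OF e(2) e(2)] pib by linarith
    also have "b \<le> 1 / (sqrt (\<kappa> * s) * sqrt (\<kappa> * (r - s)))"
      unfolding b_def using pos v0\<kappa> v\<kappa>
      by (intro divide_left_mono mult_mono mult_pos_pos) auto
    also have "\<dots> = (1 / (sqrt \<kappa> * sqrt \<kappa>)) * (1 / sqrt s * (1 / sqrt (r - s)))"
      by (simp add: real_sqrt_mult)
    also have "1 / (sqrt \<kappa> * sqrt \<kappa>) = exp (2 * B * t)"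
      using \<kappa>0 by (simp add: \<kappa>_def exp_minus inverse_eq_divide)
    finally show ?thesis unfolding DJ[OF e] .
  qed
  show "(\<lambda>n. expectation (\<lambda>\<omega>. heat_diff x (f n) (g n) (X s \<omega>) * heat_diff x (f n) (g n) (X r \<omega>))) \<longlonglongrightarrow> 0"
    if fg: "\<And>n. 0 < f n" "\<And>n. 0 < g n" "f \<longlonglongrightarrow> 0" "g \<longlonglongrightarrow> 0"
  proof -
    note lim = heat_kernel_two_point_tendsto[OF U V indep \<sigma>, of _ _ x, folded J_def]
    have "(\<lambda>n. (J (f n) (f n) - J (f n) (g n)) - (J (g n) (f n) - J (g n) (g n))) \<longlonglongrightarrow>
        (normal_density 0 (sqrt v\<^sub>0) x * normal_density 0 (sqrt v) (x - a * x) -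
         normal_density 0 (sqrt v\<^sub>0) x * normal_density 0 (sqrt v) (x - a * x)) -
        (normal_density 0 (sqrt v\<^sub>0) x * normal_density 0 (sqrt v) (x - a * x) -
         normal_density 0 (sqrt v\<^sub>0) x * normal_density 0 (sqrt v) (x - a * x))"
      by (intro tendsto_diff lim fg)
    then show ?thesis by (simp add: DJ fg)
  qed
qed

text \<open>Paths in a null set containing all discontinuous ones are replaced by 0, and times below
  0 are sent to 0. The result is continuous on the whole line for every outcome, as
  \<open>borel_measurable_continuous_process\<close> demands.\<close>

lemma continuous_version:
  assumes ad: "adapted F X" and cp: "continuous_paths M X"
  obtains Y where "(\<lambda>p. Y (fst p) (snd p)) \<in> borel_measurable (borel \<Otimes>\<^sub>M M)"
    "AE \<omega> in M. \<forall>u\<ge>0. X u \<omega> = Y u \<omega>" "\<And>u. Y u \<in> borel_measurable M"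
proof -
  have "AE \<omega> in M. continuous_on {0..} (\<lambda>t. X t \<omega>)"
    using cp by (simp add: continuous_paths_def)
  then obtain N where N: "{\<omega> \<in> space M. \<not> continuous_on {0..} (\<lambda>t. X t \<omega>)} \<subseteq> N" "N \<in> null_sets M"
    by (auto simp: eventually_ae_filter)
  then have [measurable]: "N \<in> sets M" by auto
  define Y where "Y u \<omega> = (if \<omega> \<in> N then 0 else X (max 0 u) \<omega>)" for u \<omega>
  have X[measurable]: "X (max 0 u) \<in> borel_measurable M" for u
    using ad measurable_from_subalg[OF subalg, of "max 0 u" "X (max 0 u)"]
    by (simp add: adapted_def)
  have Y: "Y u \<in> borel_measurable M" for u unfolding Y_def by measurable
  show ?thesis
  proof (rule that[of Y])
    show "(\<lambda>p. Y (fst p) (snd p)) \<in> borel_measurable (borel \<Otimes>\<^sub>M M)"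
    proof (rule borel_measurable_continuous_process[OF Y])
      fix \<omega> assume \<omega>: "\<omega> \<in> space M"
      show "continuous_on UNIV (\<lambda>t. Y t \<omega>)"
      proof (cases "\<omega> \<in> N")
        case False
        then have "continuous_on {0..} (\<lambda>t. X t \<omega>)" using N(1) \<omega> by blast
        then have "continuous_on UNIV (\<lambda>t. X (max 0 t) \<omega>)"
          by (rule continuous_on_compose2) (auto intro!: continuous_intros)
        with False show ?thesis by (simp add: Y_def)
      qed (simp add: Y_def)
    qed
    show "AE \<omega> in M. \<forall>u\<ge>0. X u \<omega> = Y u \<omega>"
      using AE_not_in[OF N(2)] by eventually_elim (simp add: Y_def max_def)
  qed (rule Y)
qed

lemma heat_kernel_local_time_exists:
  assumes BM: "brownian_motion M F W"
    and \<alpha>: "\<alpha> \<in> borel_measurable (lebesgue_on {0..})"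
    and sde: "sde_solution M F W \<alpha> X"
    and B: "\<And>u. u \<in> {0..t} \<Longrightarrow> \<bar>\<alpha> u\<bar> \<le> B" and t: "0 < t"
  shows "\<exists>L. is_local_time M X t x L"
proof -
  obtain Y where Y: "(\<lambda>p. Y (fst p) (snd p)) \<in> borel_measurable (borel \<Otimes>\<^sub>M M)"
    and XY: "AE \<omega> in M. \<forall>u\<ge>0. X u \<omega> = Y u \<omega>" and Ym[measurable]: "\<And>u. Y u \<in> borel_measurable M"
    using continuous_version[of X] sde by (auto simp: sde_solution_def)
  have Xm: "X u \<in> borel_measurable M" if "0 \<le> u" for u
    using sde that measurable_from_subalg[OF subalg, of u "X u"]
    by (simp add: sde_solution_def adapted_def)
  \<comment> \<open>Time carries Lebesgue measure on Borel sets here, the form in which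
    \<open>Y\<close> is jointly measurable; \<open>approx_local_time\<close> integrates over the
    completion.\<close>
  define R where "R = restrict_space lborel {0..t}"
  have R: "finite_measure R"
    by (rule finite_measureI) (use t in \<open>simp add: R_def emeasure_restrict_space\<close>)
  have sR: "sets R = sets (restrict_space borel {0..t})"
    by (simp add: R_def sets_restrict_space)
  interpret R: finite_measure R by (rule R)
  interpret RR: pair_sigma_finite R R ..
  note occ = second_moment_occupation_integral[OF R sR Y]
  have hk: "(\<lambda>y. heat_kernel e (y - x)) \<in> borel_measurable borel" for e by measurable
  have hb: "\<bar>heat_kernel e (y - x)\<bar> \<le> 1 / (sqrt (2 * pi) * sqrt e)" if "0 < e" for e y
    using heat_kernel_le[OF that] heat_kernel_nonneg[OF that] by simp
  define L where "L e \<omega> = (\<integral>r. heat_kernel e (Y r \<omega> - x) \<partial>R)" for e \<omega>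
  have Lm[measurable]: "L e \<in> borel_measurable M" if "0 < e" for e
    unfolding L_def by (rule occ(3)[OF hk hb[OF that]])
  \<comment> \<open>Two changes are reconciled: the modification \<open>Y\<close> for
    \<open>X\<close>, on almost every path, and Borel for Lebesgue measurable sets, which leaves the
    integral of a Borel function unchanged.\<close>
  have LA: "AE \<omega> in M. L e \<omega> = approx_local_time X t x e \<omega>" for e
    using XY AE_space
  proof eventually_elim
    case (elim \<omega>)
    have [measurable]: "(\<lambda>r. Y r \<omega>) \<in> borel_measurable borel"
      using measurable_compose[OF measurable_Pair2'[OF elim(2)] Y] by simp
    have "approx_local_time X t x e \<omega> = (\<integral>r. indicator {0..t} r *\<^sub>R heat_kernel e (Y r \<omega> - x) \<partial>lebesgue)"
      unfolding approx_local_time_def set_lebesgue_integral_def using elim(1)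
      by (intro Bochner_Integration.integral_cong refl) (auto split: split_indicator)
    also have "\<dots> = (\<integral>r. indicator {0..t} r *\<^sub>R heat_kernel e (Y r \<omega> - x) \<partial>lborel)"
      by (rule integral_completion) measurable
    also have "\<dots> = L e \<omega>"
      unfolding L_def R_def by (rule integral_restrict_space[symmetric]) simp
    finally show ?case ..
  qed
  have Am: "approx_local_time X t x e \<in> borel_measurable M" if "0 < e" for e
    by (rule borel_measurable_AE_eq[OF Lm[OF that] LA])
  have sqint: "square_integrable M (approx_local_time X t x e)" if e: "0 < e" for e
    unfolding square_integrable_def
  proof
    define K where "K = 1 / (sqrt (2 * pi) * sqrt e) * measure R (space R)"
    have K: "\<bar>L e \<omega>\<bar> \<le> K" if "\<omega> \<in> space M" for \<omega>
    proof -
      have "\<bar>L e \<omega>\<bar> \<le> (\<integral>r. \<bar>heat_kernel e (Y r \<omega> - x)\<bar> \<partial>R)"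
        unfolding L_def by (rule integral_abs_bound)
      also have "\<dots> \<le> (\<integral>r. 1 / (sqrt (2 * pi) * sqrt e) \<partial>R)"
        using occ(4)[OF hk hb[OF e] that] hb[OF e] by (intro integral_mono) auto
      finally show ?thesis by (simp add: K_def mult.commute)
    qed
    have "integrable M (\<lambda>\<omega>. (L e \<omega>)\<^sup>2)"
    proof (rule integrable_const_bound[of _ "K\<^sup>2"])
      show "AE \<omega> in M. norm ((L e \<omega>)\<^sup>2) \<le> K\<^sup>2"
      proof (rule AE_I2)
        fix \<omega> assume "\<omega> \<in> space M"
        from power_mono[OF K[OF this], of 2] show "norm ((L e \<omega>)\<^sup>2) \<le> K\<^sup>2" by simp
      qed
    qed (use Lm[OF e] in measurable)
    then show "integrable M (\<lambda>\<omega>. (approx_local_time X t x e \<omega>)\<^sup>2)"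
    proof (rule integrable_cong_AE_imp)
      show "(\<lambda>\<omega>. (approx_local_time X t x e \<omega>)\<^sup>2) \<in> borel_measurable M"
        using Am[OF e] by measurable
      show "AE \<omega> in M. (L e \<omega>)\<^sup>2 = (approx_local_time X t x e \<omega>)\<^sup>2"
        using LA[of e] by eventually_elim simp
    qed
  qed (rule Am[OF e])
  define D where "D e e' p = expectation (\<lambda>\<omega>. heat_diff x e e' (Y (fst p) \<omega>) * heat_diff x e e' (Y (snd p) \<omega>))"
    for e e' and p :: "real \<times> real"
  define \<Phi> where "\<Phi> e e' = expectation (\<lambda>\<omega>. (approx_local_time X t x e \<omega> - approx_local_time X t x e' \<omega>)\<^sup>2)" for e e'
  have \<Phi>D: "\<Phi> e e' = (\<integral>p. D e e' p \<partial>(R \<Otimes>\<^sub>M R))"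
    and Dm: "D e e' \<in> borel_measurable (R \<Otimes>\<^sub>M R)" if e: "0 < e" "0 < e'" for e e'
  proof -
    have "\<Phi> e e' = expectation (\<lambda>\<omega>. (L e \<omega> - L e' \<omega>)\<^sup>2)"
      unfolding \<Phi>_def
    proof (rule integral_cong_AE)
      show "AE \<omega> in M. (approx_local_time X t x e \<omega> - approx_local_time X t x e' \<omega>)\<^sup>2 = (L e \<omega> - L e' \<omega>)\<^sup>2"
        using LA[of e] LA[of e'] by eventually_elim simp
    qed (use Am[OF e(1)] Am[OF e(2)] Lm[OF e(1)] Lm[OF e(2)] in measurable)
    also have "\<dots> = expectation (\<lambda>\<omega>. (\<integral>r. heat_diff x e e' (Y r \<omega>) \<partial>R)\<^sup>2)"
      unfolding L_def heat_diff_def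
      using occ(4)[OF hk hb[OF e(1)]] occ(4)[OF hk hb[OF e(2)]]
      by (intro Bochner_Integration.integral_cong refl) simp
    also have "\<dots> = (\<integral>p. D e e' p \<partial>(R \<Otimes>\<^sub>M R))"
      unfolding D_def by (rule occ(1)[OF borel_measurable_heat_diff abs_heat_diff_le[OF e]])
    finally show "\<Phi> e e' = (\<integral>p. D e e' p \<partial>(R \<Otimes>\<^sub>M R))" .
    show "D e e' \<in> borel_measurable (R \<Otimes>\<^sub>M R)"
      unfolding D_def by (rule occ(2)[OF borel_measurable_heat_diff abs_heat_diff_le[OF e]])
  qed
  \<comment> \<open>Measurability of \<open>D\<close> needs \<open>Y\<close>, whereas the Gaussian
    estimates concern \<open>X\<close>; here the two meet.\<close>
  have DX: "D e e' (s, r) = expectation (\<lambda>\<omega>. heat_diff x e e' (X s \<omega>) * heat_diff x e e' (X r \<omega>))"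
    if "0 \<le> s" "0 \<le> r" for e e' s r
    unfolding D_def
  proof (rule integral_cong_AE)
    show "AE \<omega> in M. heat_diff x e e' (Y (fst (s, r)) \<omega>) * heat_diff x e e' (Y (snd (s, r)) \<omega>) =
        heat_diff x e e' (X s \<omega>) * heat_diff x e e' (X r \<omega>)"
      using XY by eventually_elim (use that in simp)
  qed (use Xm[OF that(1)] Xm[OF that(2)] in measurable)
  have Dsym: "D e e' (s, r) = D e e' (r, s)" for e e' s r
    unfolding D_def by (simp add: mult.commute)
  obtain \<psi> where \<psi>: "integrable lborel \<psi>" "\<And>u. 0 \<le> \<psi> u" "\<And>u. \<psi> (- u) = \<psi> u"
    "\<And>u. 0 < u \<Longrightarrow> u \<le> t \<Longrightarrow> \<psi> u = 1 / sqrt u"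
    using integrable_inverse_sqrt[of t] by blast
  (* The singularities at s = 0 and on the diagonal are both of order -1/2, so w is integrable. *)
  define w where "w p = exp (2 * B * t) * ((case p of (r, s) \<Rightarrow> \<psi> r * \<psi> (r - s)) + (case p of (r, s) \<Rightarrow> \<psi> s * \<psi> (r - s)))"
    for p :: "real \<times> real"
  have w: "integrable (R \<Otimes>\<^sub>M R) w"
    unfolding w_def R_def
    by (intro integrable_mult_right Bochner_Integration.integrable_add
        integrable_convolution_kernel_fst integrable_convolution_kernel_snd \<psi>) simp_all
  have w_eq: "w (s, r) = exp (2 * B * t) * (\<psi> s * \<psi> (s - r) + \<psi> r * \<psi> (s - r))" for s r
    by (simp add: w_def)
  \<comment> \<open>The two-point estimates are available only for distinct positive times; the axes
    and the diagonal form a null set.\<close>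
  have ae: "AE p in R \<Otimes>\<^sub>M R. fst p \<noteq> 0 \<and> snd p \<noteq> 0 \<and> fst p \<noteq> snd p"
  proof (rule RR.AE_pair_measure)
    have idR: "(\<lambda>x. x) \<in> R \<rightarrow>\<^sub>M borel"
      unfolding R_def by (rule measurable_restrict_space1) simp
    have [measurable]: "fst \<in> R \<Otimes>\<^sub>M R \<rightarrow>\<^sub>M borel" "snd \<in> R \<Otimes>\<^sub>M R \<rightarrow>\<^sub>M borel"
      using measurable_compose[OF measurable_fst idR] measurable_compose[OF measurable_snd idR] by auto
    show "{p \<in> space (R \<Otimes>\<^sub>M R). fst p \<noteq> 0 \<and> snd p \<noteq> 0 \<and> fst p \<noteq> snd p} \<in> sets (R \<Otimes>\<^sub>M R)"
      by measurable
    have ne: "AE r in R. r \<noteq> c" for c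
      unfolding R_def using AE_lborel_singleton[of c] by (subst AE_restrict_space_iff) auto
    show "AE s in R. AE r in R. fst (s, r) \<noteq> 0 \<and> snd (s, r) \<noteq> 0 \<and> fst (s, r) \<noteq> snd (s, r)"
      using ne[of 0]
    proof eventually_elim
      case (elim s)
      show ?case using ne[of 0] ne[of s] by eventually_elim (use elim in auto)
    qed
  qed
  have lim: "(\<lambda>n. \<Phi> (f n) (g n)) \<longlonglongrightarrow> 0"
    if fg: "\<And>n. 0 < f n" "\<And>n. 0 < g n" "f \<longlonglongrightarrow> 0" "g \<longlonglongrightarrow> 0" for f g
  proof -
    have pt: "(\<forall>n. \<bar>D (f n) (g n) p\<bar> \<le> w p) \<and> (\<lambda>n. D (f n) (g n) p) \<longlonglongrightarrow> 0"
      if p: "p \<in> space (R \<Otimes>\<^sub>M R)" "fst p \<noteq> 0 \<and> snd p \<noteq> 0 \<and> fst p \<noteq> snd p" for p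
    proof -
      \<comment> \<open>The bound is recorded for both orders of the arguments of \<open>w\<close>,
        since together with \<open>Dsym\<close> the case \<open>s < r\<close> then also settles
        pairs on the other side of the diagonal.\<close>
      have main: "(\<forall>n. \<bar>D (f n) (g n) (s, r)\<bar> \<le> w (s, r)) \<and> (\<forall>n. \<bar>D (f n) (g n) (s, r)\<bar> \<le> w (r, s)) \<and>
          (\<lambda>n. D (f n) (g n) (s, r)) \<longlonglongrightarrow> 0" if sr: "0 < s" "s < r" "r \<le> t" for s r
      proof -
        note two = heat_diff_two_point[OF BM \<alpha> sde B sr, of _ _ x]
        have D: "D e e' (s, r) = expectation (\<lambda>\<omega>. heat_diff x e e' (X s \<omega>) * heat_diff x e e' (X r \<omega>))" for e e'
          using DX sr by simp
        have \<psi>rs: "\<psi> (r - s) = 1 / sqrt (r - s)" "\<psi> s = 1 / sqrt s" "\<psi> (s - r) = \<psi> (r - s)"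
          using \<psi>(4)[of "r - s"] \<psi>(4)[of s] \<psi>(3)[of "r - s"] sr by auto
        have b: "\<bar>D (f n) (g n) (s, r)\<bar> \<le> exp (2 * B * t) * (\<psi> s * \<psi> (r - s))" for n
          unfolding D \<psi>rs by (rule two(1)) (use fg in auto)
        have "0 \<le> \<psi> r * \<psi> (r - s)" using \<psi>(2) by simp
        then have "exp (2 * B * t) * (\<psi> s * \<psi> (r - s)) \<le> w (s, r)" "exp (2 * B * t) * (\<psi> s * \<psi> (r - s)) \<le> w (r, s)"
          unfolding w_eq \<psi>rs(3) by (intro mult_left_mono; simp)+
        moreover have "(\<lambda>n. D (f n) (g n) (s, r)) \<longlonglongrightarrow> 0"
          unfolding D by (rule two(2)) (use fg in auto)
        ultimately show ?thesis using b by (meson order.trans)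
      qed
      obtain s r where sr: "p = (s, r)" by (cases p)
      have mem: "0 < s" "0 < r" "s \<le> t" "r \<le> t" "s \<noteq> r"
        using p unfolding sr by (auto simp: R_def space_pair_measure space_restrict_space)
      show ?thesis
      proof (cases "s < r")
        case True
        then show ?thesis using main[of s r] mem unfolding sr by blast
      next
        case False
        then have "r < s" using mem by simp
        then show ?thesis using main[of r s] mem unfolding sr Dsym[of _ _ s r] by blast
      qed
    qed
    have "(\<lambda>n. \<integral>p. D (f n) (g n) p \<partial>(R \<Otimes>\<^sub>M R)) \<longlonglongrightarrow> (\<integral>p. 0 \<partial>(R \<Otimes>\<^sub>M R))"
    proof (rule integral_dominated_convergence[OF _ _ w])
      show "D (f n) (g n) \<in> borel_measurable (R \<Otimes>\<^sub>M R)" for n by (rule Dm[OF fg(1,2)])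
      show "AE p in R \<Otimes>\<^sub>M R. (\<lambda>n. D (f n) (g n) p) \<longlonglongrightarrow> 0"
        using ae AE_space by eventually_elim (use pt in blast)
      show "AE p in R \<Otimes>\<^sub>M R. norm (D (f n) (g n) p) \<le> w p" for n
        using ae AE_space by eventually_elim (use pt in \<open>simp add: real_norm_def\<close>)
    qed simp
    then show ?thesis by (simp add: \<Phi>D fg)
  qed
  \<comment> \<open>Dominated convergence speaks about sequences. If the Cauchy criterion failed,
    choosing a bad pair of widths below \<open>1 / Suc n\<close> for each \<open>n\<close> would
    give two sequences that contradict \<open>lim\<close>.\<close>
  have "\<exists>\<delta>>0. \<forall>e e'. 0 < e \<and> e < \<delta> \<and> 0 < e' \<and> e' < \<delta> \<longrightarrow> \<Phi> e e' < \<eta>" if \<eta>: "0 < \<eta>" for \<eta>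
  proof (rule ccontr)
    assume neg: "\<not> ?thesis"
    have "\<exists>p. 0 < fst p \<and> fst p < 1 / real (Suc n) \<and> 0 < snd p \<and> snd p < 1 / real (Suc n) \<and> \<eta> \<le> \<Phi> (fst p) (snd p)" for n
    proof -
      have "0 < 1 / real (Suc n)" by simp
      with neg obtain e e' where "0 < e" "e < 1 / real (Suc n)" "0 < e'" "e' < 1 / real (Suc n)" "\<not> \<Phi> e e' < \<eta>"
        by blast
      then show ?thesis by (intro exI[of _ "(e, e')"]) simp
    qed
    then obtain h where h: "\<And>n. 0 < fst (h n) \<and> fst (h n) < 1 / real (Suc n) \<and> 0 < snd (h n) \<and>
        snd (h n) < 1 / real (Suc n) \<and> \<eta> \<le> \<Phi> (fst (h n)) (snd (h n))"
      by metis
    have inv: "(\<lambda>n. 1 / real (Suc n)) \<longlonglongrightarrow> 0"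
      using LIMSEQ_inverse_real_of_nat by (simp add: inverse_eq_divide)
    have "(\<lambda>n. \<Phi> (fst (h n)) (snd (h n))) \<longlonglongrightarrow> 0"
    proof (rule lim)
      show "(\<lambda>n. fst (h n)) \<longlonglongrightarrow> 0"
        by (rule real_tendsto_sandwich[OF _ _ tendsto_const inv]; rule always_eventually, rule allI)
          (use h in \<open>auto intro: less_imp_le\<close>)
      show "(\<lambda>n. snd (h n)) \<longlonglongrightarrow> 0"
        by (rule real_tendsto_sandwich[OF _ _ tendsto_const inv]; rule always_eventually, rule allI)
          (use h in \<open>auto intro: less_imp_le\<close>)
    qed (use h in auto)
    then have "\<eta> \<le> 0" using h by (intro tendsto_lowerbound[of _ 0 sequentially \<eta>]) auto
    with \<eta> show False by simp
  qed
  from L2_Cauchy_at_right_imp_convergent[OF sqint this[unfolded \<Phi>_def] finite_measure_axioms]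
  show ?thesis using sqint unfolding is_local_time_def by blast
qed

end

theorem theorem3p1:
  fixes M :: "'a measure" and F :: "real \<Rightarrow> 'a measure"
    and W X :: "real \<Rightarrow> 'a \<Rightarrow> real" and \<alpha> :: "real \<Rightarrow> real"
  assumes "complete_filtered_prob_space M F"
    and "brownian_motion M F W"
    and "\<alpha> \<in> borel_measurable (lebesgue_on {0..})"
    and "\<forall>T\<ge>0. bounded (\<alpha> ` {0..T})"
    and "sde_solution M F W \<alpha> X"
  shows "\<forall>t>0. \<forall>x. \<exists>L. is_local_time M X t x L"
proof (intro allI impI)
  fix t x :: real assume t: "0 < t"
  interpret complete_filtered_prob_space M F by fact
  have "bounded (\<alpha> ` {0..t})" using assms(4) t by simp
  then obtain B where "\<forall>y\<in>\<alpha> ` {0..t}. norm y \<le> B" unfolding bounded_iff by blast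
  then have "\<bar>\<alpha> u\<bar> \<le> B" if "u \<in> {0..t}" for u using that by simp
  then show "\<exists>L. is_local_time M X t x L"
    by (rule heat_kernel_local_time_exists[OF assms(2,3,5) _ t])
qed

end
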